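(* Suppose that $D$ admits right derivatives everywhere on $[0,T)$ (denoted $D'_+(t)$), that $\pi$ is positive, and that $\inf_{t\in[0,T)}D'_+(t)$ is positive. Then there is an algorithm which, for any positive integer $M$, computes in time $O\left(\beta^{3S}M^{3S+2}\right)$ a feasible solution $(\boldsymbol d,\boldsymbol y)$ of P$^{\max}_{\text{return}}$ satisfying $$g^{\max}(\boldsymbol d,\boldsymbol y)\leq OPT+O\left(\frac{S^2}{M}\right),$$ where $OPT$ is the optimal value of P$^{\max}_{\text{return}}$ and $\beta$ depends only on the constants of the computational model.
   Context: Data: a positive integer $S$ (number of shuttles), a capacity $C>0$, a period length $T$, a loading rate $\nu\geq 0$, a return time $\pi\geq 0$, and a nondecreasing upper semicontinuous function $D:[0,T]\to\mathbb{R}_+$ with $D(T)>0$ (cumulative demand). Pseudo-inverses of $D$: for $y\in[0,D(T)]$, $\tau(y)=\inf\{t\in[0,T]: D(t)>y\}$ if $y<D(T)$ and $\tau(D(T))=T$; $\bar\tau(y)=\inf\{t\in[0,T]: D(t)\geq y\}$. Problem P$^{\max}_{\text{return}}$: over sequences of nonnegative reals $\boldsymbol d=(d_j)_{j\geq 1}$, $\boldsymbol y=(y_j)_{j\geq 1}$, with $y_0=0$, minimize $$g^{\max}(\boldsymbol d,\boldsymbol y)=\max_{j:\,y_j>y_{j-1}}\big(d_j-\tau(y_{j-1})\big)$$ (understood as a supremum, possibly $+\infty$) subject to: (i) $y_j-y_{j-1}\leq C$ for $j\geq 1$; (ii) $y_{j-1}\leq y_j$ for $j\geq 1$; (iii)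 $d_{j-1}\leq d_j$ for $j\geq 2$; (iv) $\lim_{j\to+\infty}y_j=D(T)$; (v) $\bar\tau(y_j)+\nu(y_j-y_{j-1})\leq d_j$ for $j\geq 1$; (vi) $d_j+\pi+\nu(y_{j+S}-y_{j+S-1})\leq d_{j+S}$ for $j\geq 1$. Computational model: the following operations take constant time: evaluation of $D(t)$ for any $t\in[0,T]$; integration of $D$ between two values; evaluation of $\tau(y)$ and $\bar\tau(y)$ for any $y$; evaluation of $\sup\{y:\bar\tau(y)+\nu y\leq\alpha\}$ for any $\alpha\in\mathbb{R}_+$. The constants of the computational model are $C$, $T$, $D(\cdot)$, $\nu$, $\pi$ (the constants hidden in the $O$-notations may depend on them, but not on $S$ or $M$). *)

theory Defs
  imports "HOL-Analysis.Analysis"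
begin

section \<open>The shuttle problem\<close>

definition upper_semicontinuous_on :: "real set \<Rightarrow> (real \<Rightarrow> real) \<Rightarrow> bool" where
  "upper_semicontinuous_on A f \<longleftrightarrow>
     (\<forall>x\<in>A. \<forall>c>f x. \<forall>\<^sub>F s in at x within A. f s < c)"

text \<open>Only the restriction of \<open>demand\<close> to \<open>[0, period]\<close> is meaningful. The number of shuttles is
  kept out of the record, as it is not one of the constants that asymptotic bounds may depend on.\<close>

record service =
  capacity :: real
  period :: real
  loading :: real
  return_time :: real
  demand :: "real \<Rightarrow> real"

definition valid_service :: "service \<Rightarrow> bool" where
  "valid_service P \<longleftrightarrow>
     capacity P > 0 \<and> period P > 0 \<and> loading P \<ge> 0 \<and> return_time P \<ge> 0 \<and>
     (\<forall>t\<in>{0..period P}. demand P t \<ge> 0) \<and>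
     mono_on {0..period P} (demand P) \<and>
     upper_semicontinuous_on {0..period P} (demand P) \<and>
     demand P (period P) > 0"

definition total_demand :: "service \<Rightarrow> real" where
  "total_demand P = demand P (period P)"

definition tau :: "service \<Rightarrow> real \<Rightarrow> real" where
  "tau P y = (if y < total_demand P then Inf {t\<in>{0..period P}. demand P t > y} else period P)"

definition taubar :: "service \<Rightarrow> real \<Rightarrow> real" where
  "taubar P y = Inf {t\<in>{0..period P}. demand P t \<ge> y}"

text \<open>Sequences are indexed from 1; \<open>y 0\<close> is the conventional value 0 and \<open>d 0\<close> is irrelevant.\<close>

definition feasible_return ::
    "service \<Rightarrow> nat \<Rightarrow> (nat \<Rightarrow> real) \<Rightarrow> (nat \<Rightarrow> real) \<Rightarrow> bool" where
  "feasible_return P S d y \<longleftrightarrow>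
     y 0 = 0 \<and>
     (\<forall>j\<ge>1. d j \<ge> 0 \<and> y j \<ge> 0) \<and>
     (\<forall>j\<ge>1. y j - y (j - 1) \<le> capacity P) \<and>
     (\<forall>j\<ge>1. y (j - 1) \<le> y j) \<and>
     (\<forall>j\<ge>2. d (j - 1) \<le> d j) \<and>
     y \<longlonglongrightarrow> total_demand P \<and>
     (\<forall>j\<ge>1. taubar P (y j) + loading P * (y j - y (j - 1)) \<le> d j) \<and>
     (\<forall>j\<ge>1. d j + return_time P + loading P * (y (j + S) - y (j + S - 1)) \<le> d (j + S))"

definition g_max :: "service \<Rightarrow> (nat \<Rightarrow> real) \<Rightarrow> (nat \<Rightarrow> real) \<Rightarrow> ereal" where
  "g_max P d y = (SUP j\<in>{j. j \<ge> 1 \<and> y j > y (j - 1)}. ereal (d j - tau P (y (j - 1))))"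

definition OPT_return :: "service \<Rightarrow> nat \<Rightarrow> ereal" where
  "OPT_return P S = (INF (d, y) \<in> {(d, y). feasible_return P S d y}. g_max P d y)"


section \<open>The computational model\<close>

text \<open>A real RAM, given as an imperative language over finitely many unbounded arrays (named by
  strings) of naturals and of reals; scalars are entries at index 0. Naturals serve as addresses and
  can be converted to reals. There is no rounding operation from reals to naturals, and the only
  constants a program can contain are naturals, so that no real-valued advice can be hidden in a
  program. The data of the problem are accessible as read-only values and through queries, which
  return 0 outside of their domain.\<close>

datatype query = Demand | Tau | Taubar | LoadSup

datatype nexp =
    NConst nat
  | NGet string nexp
  | NAdd nexp nexp
  | NSub nexp nexp
  | NMul nexp nexp

datatype rexp =
    OfNat nexp
  | RGet string nexp
  | Capacity | Period | Loading | ReturnTime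
  | RAdd rexp rexp
  | RSub rexp rexp
  | RMul rexp rexp
  | RDiv rexp rexp
  | Query query rexp
  | IntegralDemand rexp rexp

datatype bexp =
    NLess nexp nexp
  | RLess rexp rexp
  | Not bexp
  | And bexp bexp

datatype com =
    Skip
  | NSet string nexp nexp
  | RSet string nexp rexp
  | Seq com com
  | If bexp com com
  | While bexp com

record state =
  nats :: "string \<Rightarrow> nat \<Rightarrow> nat"
  reals :: "string \<Rightarrow> nat \<Rightarrow> real"

fun query_val :: "service \<Rightarrow> query \<Rightarrow> real \<Rightarrow> real" where
  "query_val P Demand x = (if x \<in> {0..period P} then demand P x else 0)"
| "query_val P Tau x = (if x \<in> {0..total_demand P} then tau P x else 0)"
| "query_val P Taubar x = (if x \<in> {0..total_demand P} then taubar P x else 0)"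
| "query_val P LoadSup x =
     (if x \<ge> 0 then Sup {y\<in>{0..total_demand P}. taubar P y + loading P * y \<le> x} else 0)"

fun nval :: "nexp \<Rightarrow> state \<Rightarrow> nat" where
  "nval (NConst k) s = k"
| "nval (NGet a i) s = nats s a (nval i s)"
| "nval (NAdd e f) s = nval e s + nval f s"
| "nval (NSub e f) s = nval e s - nval f s"
| "nval (NMul e f) s = nval e s * nval f s"

fun rval :: "service \<Rightarrow> rexp \<Rightarrow> state \<Rightarrow> real" where
  "rval P (OfNat e) s = real (nval e s)"
| "rval P (RGet a i) s = reals s a (nval i s)"
| "rval P Capacity s = capacity P"
| "rval P Period s = period P"
| "rval P Loading s = loading P"
| "rval P ReturnTime s = return_time P"
| "rval P (RAdd e f) s = rval P e s + rval P f s"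
| "rval P (RSub e f) s = rval P e s - rval P f s"
| "rval P (RMul e f) s = rval P e s * rval P f s"
| "rval P (RDiv e f) s = rval P e s / rval P f s"
| "rval P (Query q e) s = query_val P q (rval P e s)"
| "rval P (IntegralDemand e f) s =
     (if 0 \<le> rval P e s \<and> rval P f s \<le> period P
      then integral {rval P e s..rval P f s} (demand P) else 0)"

fun bval :: "service \<Rightarrow> bexp \<Rightarrow> state \<Rightarrow> bool" where
  "bval P (NLess e f) s = (nval e s < nval f s)"
| "bval P (RLess e f) s = (rval P e s < rval P f s)"
| "bval P (Not b) s = (\<not> bval P b s)"
| "bval P (And b c) s = (bval P b s \<and> bval P c s)"

definition set_nat :: "string \<Rightarrow> nat \<Rightarrow> nat \<Rightarrow> state \<Rightarrow> state" where
  "set_nat a i v s = s\<lparr>nats := (nats s)(a := (nats s a)(i := v))\<rparr>"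

definition set_real :: "string \<Rightarrow> nat \<Rightarrow> real \<Rightarrow> state \<Rightarrow> state" where
  "set_real a i v s = s\<lparr>reals := (reals s)(a := (reals s a)(i := v))\<rparr>"

text \<open>\<open>exec P c s n s'\<close>: program \<open>c\<close> started in \<open>s\<close> terminates in \<open>s'\<close> after \<open>n\<close> steps. Every
  assignment and every test is one step: a fixed program contains finitely many expressions, so each
  step performs a number of elementary operations and queries bounded by a constant.\<close>

inductive exec :: "service \<Rightarrow> com \<Rightarrow> state \<Rightarrow> nat \<Rightarrow> state \<Rightarrow> bool" for P :: service where
  Skip: "exec P Skip s 1 s"
| NSet: "exec P (NSet a i e) s 1 (set_nat a (nval i s) (nval e s) s)"
| RSet: "exec P (RSet a i e) s 1 (set_real a (nval i s) (rval P e s) s)"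
| Seq: "\<lbrakk> exec P c s m s'; exec P c' s' n s'' \<rbrakk> \<Longrightarrow> exec P (Seq c c') s (m + n) s''"
| IfTrue: "\<lbrakk> bval P b s; exec P c s n s' \<rbrakk> \<Longrightarrow> exec P (If b c c') s (Suc n) s'"
| IfFalse: "\<lbrakk> \<not> bval P b s; exec P c' s n s' \<rbrakk> \<Longrightarrow> exec P (If b c c') s (Suc n) s'"
| WhileFalse: "\<not> bval P b s \<Longrightarrow> exec P (While b c) s 1 s"
| WhileTrue: "\<lbrakk> bval P b s; exec P c s m s'; exec P (While b c) s' n s'' \<rbrakk>
    \<Longrightarrow> exec P (While b c) s (Suc (m + n)) s''"

definition input_state :: "nat \<Rightarrow> nat \<Rightarrow> state" where
  "input_state S M =
     set_nat ''S'' 0 S (set_nat ''M'' 0 M \<lparr>nats = (\<lambda>_ _. 0), reals = (\<lambda>_ _. 0)\<rparr>)"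

text \<open>An infinite solution is output as a number \<open>n\<close> of departures with the entries
  \<open>1, \<dots>, n\<close> of the arrays \<open>d\<close> and \<open>y\<close>. It stands for the pair of sequences in which all further
  shuttles leave empty, \<open>\<pi>\<close> apart from each other.\<close>

definition output_y :: "state \<Rightarrow> nat \<Rightarrow> real" where
  "output_y s j = (if j = 0 then 0 else reals s ''y'' (min j (nats s ''n'' 0)))"

definition output_d :: "service \<Rightarrow> state \<Rightarrow> nat \<Rightarrow> real" where
  "output_d P s j =
     (let n = nats s ''n'' 0
      in reals s ''d'' (min j n) + real (j - n) * return_time P)"

end

theory Submission
  imports Defs
begin

text \<open>A lower bound on the slope of the demand makes \<open>\<tau>bar\<close> Lipschitz continuous
  (\<open>taubar_lipschitz\<close>), hence rounding loads and times to a grid of step \<open>O(1/M)\<close> is a small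
  perturbation. The algorithm is an exact dynamic program over the solutions that live on a grid: the
  cumulative loads are \<open>min (D(T)) (k C / M)\<close> and the departure times are \<open>l \<pi> / M - \<pi>\<close>.

  Rounding is done upwards (\<open>round_departures\<close>). For the loads, the capacity constraint survives
  because \<open>C\<close> is a multiple of the step; for the objective, rounding up is no loss since the delay of
  departure \<open>j\<close> is measured from \<open>\<tau>(y\<^sub>j\<^sub>-\<^sub>1)\<close>, which can only increase. The times are delayed by a
  constant that pays for the change of \<open>\<tau>bar\<close>, and by an additional \<open>O(1/M)\<close> each time a shuttle
  comes back, which pays for the rounding of its previous departure. As \<open>\<pi> > 0\<close>, a shuttle makes
  only a bounded number of useful trips: a solution that is no worse than the naive one (full shuttles,
  far apart) has no loaded departure after a fixed date, and at least \<open>\<pi>\<close> elapses between a departure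
  and the \<open>S\<close>-th next one. So the total error is \<open>O(1/M)\<close>, which is \<open>O(S\<^sup>2/M)\<close>, and
  \<open>O(S)\<close> departures suffice.

  What the future needs to know about the past is the current cumulative load and the last \<open>S\<close>
  departure times. With \<open>X = O(M)\<close> levels and instants this makes at most \<open>X^(S+1)\<close> states, each
  encoded as a natural number, and at most \<open>X\<^sup>2\<close> continuations of each. The Bellman equations
  (\<open>wait\<close>) minimise the largest delay over the remaining departures. Decoding a state or a
  continuation by repeated subtraction costs at most \<open>O(X^(S+1))\<close> or \<open>O(X)\<close>, so one layer takes
  \<open>O(X^(2S+2) + X^(S+4))\<close> steps, which is \<open>O(X^(3S+2))\<close> because \<open>S \<ge> 1\<close>
  (\<open>total_time_le\<close>). The factor \<open>O(S)\<close> for the layers disappears in \<open>\<beta>^(3S)\<close>.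

  The program stores the values of all layers and reads a solution off by following the minimising
  continuations from the empty state (\<open>wp_read_plan\<close>, \<open>plan_correct\<close>). Its running time is
  derived together with its correctness in a weakest-precondition calculus whose postconditions also
  speak about the number of steps.\<close>

section \<open>Inverses of the demand\<close>

lemma valid_serviceD:
  assumes "valid_service P"
  shows "capacity P > 0" "period P > 0" "loading P \<ge> 0" "return_time P \<ge> 0"
    "\<And>t. 0 \<le> t \<Longrightarrow> t \<le> period P \<Longrightarrow> demand P t \<ge> 0"
    "\<And>s t. 0 \<le> s \<Longrightarrow> s \<le> t \<Longrightarrow> t \<le> period P \<Longrightarrow> demand P s \<le> demand P t"
    "total_demand P > 0"
  using assms unfolding valid_service_def total_demand_def mono_on_def by auto

text \<open>A nondecreasing function only jumps upwards, so \<open>f u - b u\<close> cannot drop at the limit from the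
  left; and the right derivative prevents it from dropping to the right. The supremum of the points up
  to which it has not fallen below its initial value is therefore the right end point.\<close>

lemma growth_from_right_derivative:
  fixes f D' :: "real \<Rightarrow> real"
  assumes mono: "mono_on {0..T} f"
    and deriv: "\<And>t. 0 \<le> t \<Longrightarrow> t < T \<Longrightarrow> (f has_real_derivative D' t) (at_right t)"
    and slope: "\<And>t. 0 \<le> t \<Longrightarrow> t < T \<Longrightarrow> b < D' t"
    and "0 \<le> b" "0 \<le> s" "s \<le> t" "t \<le> T"
  shows "f s + b * (t - s) \<le> f t"
proof -
  define g where "g u = f u - b * u" for u
  define X where "X = {u \<in> {s..t}. g s \<le> g u}"
  define m where "m = Sup X"
  have sX: "s \<in> X" and bdd: "bdd_above X"
    using assms by (auto simp: X_def bdd_above_def)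
  have m: "s \<le> m" "m \<le> t"
  proof -
    show "s \<le> m" unfolding m_def by (rule cSup_upper[OF sX bdd])
    show "m \<le> t" unfolding m_def by (rule cSup_least) (use sX in \<open>auto simp: X_def\<close>)
  qed
  \<comment> \<open>Points of \<open>X\<close> accumulate at \<open>m\<close> from the left, where \<open>f\<close> can only increase.\<close>
  have gm: "g s \<le> g m"
  proof (rule field_le_epsilon)
    fix e :: real assume "0 < e"
    define e' where "e' = e / (b + 1)"
    have e': "0 < e'" "b * e' \<le> e"
      using \<open>0 < e\<close> \<open>0 \<le> b\<close> by (auto simp: e'_def field_simps)
    have "m - e' < Sup X" using e'(1) by (simp add: m_def)
    then obtain u where u: "u \<in> X" "m - e' < u"
      using less_cSup_iff[of X "m - e'"] sX bdd by auto
    have "u \<le> m" using cSup_upper[OF u(1) bdd] by (simp add: m_def)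
    then have "f u \<le> f m"
      using u(1) m assms by (intro mono_onD[OF mono]) (auto simp: X_def)
    moreover have "b * (m - u) \<le> b * e'"
      using u(2) \<open>0 \<le> b\<close> by (intro mult_left_mono) auto
    moreover have "g s \<le> g u" using u(1) by (simp add: X_def)
    ultimately show "g s \<le> g m + e" using e'(2) by (simp add: g_def algebra_simps)
  qed
  have "m = t"
  proof (rule ccontr)
    assume "m \<noteq> t"
    with m have mt: "m < t" by simp
    have "((\<lambda>u. (f u - f m) / (u - m)) \<longlongrightarrow> D' m) (at_right m)"
      using deriv[of m] mt m assms by (simp add: has_field_derivative_iff)
    then have "\<forall>\<^sub>F u in at_right m. b < (f u - f m) / (u - m)"
      using slope[of m] mt m assms by (intro order_tendstoD) auto
    moreover have "\<forall>\<^sub>F u in at_right m. u < t"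
      using mt by (intro order_tendstoD(2)[OF tendsto_ident_at])
    moreover have "\<forall>\<^sub>F u in at_right m. m < u"
      by (simp add: eventually_at_filter)
    ultimately have "\<forall>\<^sub>F u in at_right m. m < u \<and> u < t \<and> b < (f u - f m) / (u - m)"
      by eventually_elim auto
    then obtain u where u: "m < u" "u < t" "b < (f u - f m) / (u - m)"
      using eventually_happens'[OF trivial_limit_at_right_real] by blast
    then have "g m \<le> g u" by (auto simp: g_def field_simps)
    then have "u \<in> X" using gm u m by (auto simp: X_def)
    then have "u \<le> m" using cSup_upper[OF _ bdd] by (simp add: m_def)
    then show False using u by simp
  qed
  then show ?thesis using gm by (simp add: g_def algebra_simps)
qed

lemma right_derivative_nonneg:
  fixes f :: "real \<Rightarrow> real"
  assumes "mono_on {0..T} f" "(f has_real_derivative D) (at_right t)" "0 \<le> t" "t < T"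
  shows "0 \<le> D"
proof (rule tendsto_lowerbound)
  show "((\<lambda>u. (f u - f t) / (u - t)) \<longlongrightarrow> D) (at_right t)"
    using assms by (simp add: has_field_derivative_iff)
  have "\<forall>\<^sub>F u in at_right t. u < T" using assms by (intro order_tendstoD(2)[OF tendsto_ident_at])
  moreover have "\<forall>\<^sub>F u in at_right t. t < u" by (simp add: eventually_at_filter)
  ultimately show "\<forall>\<^sub>F u in at_right t. 0 \<le> (f u - f t) / (u - t)"
    by eventually_elim (use assms in \<open>auto intro!: divide_nonneg_nonneg mono_onD[OF assms(1)]\<close>)
qed simp

text \<open>Half of the infimum is used, so that the slope is exceeded strictly at every point.\<close>

lemma demand_growth:
  assumes "valid_service P"
    and "\<forall>t\<in>{0..<period P}. (demand P has_real_derivative D' t) (at_right t)"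
    and "(INF t\<in>{0..<period P}. D' t) > 0"
  obtains b where "b > 0"
    "\<And>s t. 0 \<le> s \<Longrightarrow> s \<le> t \<Longrightarrow> t \<le> period P \<Longrightarrow> demand P s + b * (t - s) \<le> demand P t"
proof -
  define b where "b = (INF t\<in>{0..<period P}. D' t) / 2"
  have mono: "mono_on {0..period P} (demand P)" using assms by (simp add: valid_service_def)
  have "bdd_below (D' ` {0..<period P})"
    using right_derivative_nonneg[OF mono] assms(2) by (auto intro!: bdd_belowI2[of _ 0])
  then have "(INF t\<in>{0..<period P}. D' t) \<le> D' t" if "0 \<le> t" "t < period P" for t
    using that by (intro cINF_lower) auto
  then have "b < D' t" if "0 \<le> t" "t < period P" for t
    using that assms(3) unfolding b_def by (smt (verit) field_sum_of_halves)
  then have "demand P s + b * (t - s) \<le> demand P t" if "0 \<le> s" "s \<le> t" "t \<le> period P" for s t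
    using growth_from_right_derivative[OF mono, of D' b s t] assms that by (auto simp: b_def)
  moreover have "b > 0" using assms(3) by (simp add: b_def)
  ultimately show ?thesis using that by blast
qed

lemma taubar_bounds:
  assumes "valid_service P" "y \<le> total_demand P"
  shows "0 \<le> taubar P y" "taubar P y \<le> period P"
proof -
  let ?A = "{t\<in>{0..period P}. demand P t \<ge> y}"
  have "period P \<in> ?A" using assms valid_serviceD(2)[of P] by (auto simp: total_demand_def)
  then show "0 \<le> taubar P y" "taubar P y \<le> period P"
    unfolding taubar_def by (auto intro!: cInf_greatest cInf_lower bdd_belowI[of _ 0])
qed

lemma tau_bounds:
  assumes "valid_service P"
  shows "0 \<le> tau P y" "tau P y \<le> period P"
proof -
  let ?A = "{t\<in>{0..period P}. demand P t > y}"
  have T: "0 < period P" using assms valid_serviceD by blast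
  have "0 \<le> tau P y \<and> tau P y \<le> period P"
  proof (cases "y < total_demand P")
    case True
    then have "period P \<in> ?A" using T by (auto simp: total_demand_def)
    then show ?thesis unfolding tau_def using T
      by (auto intro!: cInf_greatest cInf_lower bdd_belowI[of _ 0])
  qed (use T in \<open>auto simp: tau_def\<close>)
  then show "0 \<le> tau P y" "tau P y \<le> period P" by auto
qed

lemma tau_mono:
  assumes "valid_service P" "x \<le> y"
  shows "tau P x \<le> tau P y"
proof (cases "y < total_demand P")
  case True
  have "period P \<in> {t\<in>{0..period P}. demand P t > y}"
    using True valid_serviceD(2)[OF assms(1)] by (auto simp: total_demand_def)
  then have "Inf {t\<in>{0..period P}. demand P t > x} \<le> Inf {t\<in>{0..period P}. demand P t > y}"
    using assms by (intro cInf_superset_mono) (auto intro!: bdd_belowI[of _ 0])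
  then show ?thesis using True assms by (simp add: tau_def)
next
  case False
  then show ?thesis using tau_bounds(2)[OF assms(1)] by (simp add: tau_def[of P y])
qed

lemma tau_le_taubar:
  assumes "valid_service P" "x < y" "y \<le> total_demand P"
  shows "tau P x \<le> taubar P y"
proof -
  have "period P \<in> {t\<in>{0..period P}. demand P t \<ge> y}"
    using assms valid_serviceD(2)[OF assms(1)] by (auto simp: total_demand_def)
  then have "Inf {t\<in>{0..period P}. demand P t > x} \<le> Inf {t\<in>{0..period P}. demand P t \<ge> y}"
    using assms by (intro cInf_superset_mono) (auto intro!: bdd_belowI[of _ 0])
  then show ?thesis using assms by (simp add: tau_def taubar_def)
qed

text \<open>Once the demand has reached \<open>x\<close>, it needs at most \<open>(y - x) / b\<close> further time units to
  reach \<open>y\<close>, unless the period ends before.\<close>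

lemma taubar_lipschitz:
  assumes "valid_service P" "b > 0"
    and growth: "\<And>s t. 0 \<le> s \<Longrightarrow> s \<le> t \<Longrightarrow> t \<le> period P \<Longrightarrow>
      demand P s + b * (t - s) \<le> demand P t"
    and "x \<le> y" "y \<le> total_demand P"
  shows "taubar P y \<le> taubar P x + (y - x) / b"
proof -
  let ?A = "{t\<in>{0..period P}. demand P t \<ge> x}"
  have "period P \<in> ?A"
    using assms valid_serviceD(2)[OF assms(1)] by (auto simp: total_demand_def)
  have "taubar P y - (y - x) / b \<le> t" if "t \<in> ?A" for t
  proof (cases "t + (y - x) / b \<le> period P")
    case True
    have "0 \<le> (y - x) / b" using assms by simp
    then have "demand P t + b * ((t + (y - x) / b) - t) \<le> demand P (t + (y - x) / b)"
      using that True by (intro growth) auto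
    then have "y \<le> demand P (t + (y - x) / b)" using that \<open>b > 0\<close> by simp
    then have "taubar P y \<le> t + (y - x) / b"
      unfolding taubar_def using that True \<open>0 \<le> (y - x) / b\<close>
      by (intro cInf_lower) (auto intro!: bdd_belowI[of _ 0])
    then show ?thesis by simp
  next
    case False
    then show ?thesis using taubar_bounds(2)[OF assms(1,5)] by simp
  qed
  then have "taubar P y - (y - x) / b \<le> Inf ?A"
    using \<open>period P \<in> ?A\<close> by (intro cInf_greatest) auto
  then show ?thesis by (simp add: taubar_def)
qed

section \<open>Dynamic programming on a grid\<close>

lemma digits_less_power:
  fixes f :: "nat \<Rightarrow> nat"
  assumes "\<And>i. f i < B"
  shows "(\<Sum>i<m. f i * B ^ i) < B ^ m"
proof (induction m)
  case (Suc m)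
  have "(\<Sum>i<Suc m. f i * B ^ i) < B ^ m + f m * B ^ m" using Suc by simp
  also have "\<dots> = Suc (f m) * B ^ m" by simp
  also have "\<dots> \<le> B * B ^ m" using assms[of m] by (intro mult_right_mono) auto
  finally show ?case by simp
qed simp

text \<open>Shifting the indices removes all subtractions but the one in the formula itself.\<close>

lemma feasible_return_Suc:
  "feasible_return P S d y \<longleftrightarrow>
     y 0 = 0 \<and>
     (\<forall>j. 0 \<le> d (Suc j) \<and> 0 \<le> y (Suc j)) \<and>
     (\<forall>j. y (Suc j) - y j \<le> capacity P) \<and>
     (\<forall>j. y j \<le> y (Suc j)) \<and>
     (\<forall>j. d (Suc j) \<le> d (Suc (Suc j))) \<and>
     y \<longlonglongrightarrow> total_demand P \<and>
     (\<forall>j. taubar P (y (Suc j)) + loading P * (y (Suc j) - y j) \<le> d (Suc j)) \<and>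
     (\<forall>j. d (Suc j) + return_time P + loading P * (y (Suc j + S) - y (j + S)) \<le> d (Suc j + S))"
proof -
  have shift: "(\<forall>j\<ge>Suc i. R j) \<longleftrightarrow> (\<forall>j\<ge>i. R (Suc j))" for R :: "nat \<Rightarrow> bool" and i
    by (metis Suc_le_D Suc_le_mono)
  show ?thesis
    unfolding feasible_return_def One_nat_def numeral_2_eq_2 shift[of 0] shift[of "Suc 0"]
    by simp
qed

lemma feasible_returnI:
  assumes "y 0 = 0" "\<And>j. 0 \<le> d (Suc j)" "\<And>j. y (Suc j) - y j \<le> capacity P"
    and mono: "\<And>j. y j \<le> y (Suc j)" and "\<And>j. 1 \<le> j \<Longrightarrow> d j \<le> d (Suc j)"
    and "y \<longlonglongrightarrow> total_demand P"
    and "\<And>j. taubar P (y (Suc j)) + loading P * (y (Suc j) - y j) \<le> d (Suc j)"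
    and ret: "\<And>j. 1 \<le> j \<Longrightarrow>
      d j + return_time P + loading P * (y (j + S) - y (j + S - 1)) \<le> d (j + S)"
  shows "feasible_return P S d y"
proof -
  have nonneg: "0 \<le> y j" for j
    using \<open>y 0 = 0\<close> by (induction j) (use mono order_trans in \<open>auto\<close>)
  show ?thesis
    unfolding feasible_return_Suc using assms(1-7) nonneg ret[of "Suc j" for j] by simp
qed

text \<open>The solution that fills every shuttle and lets the \<open>j\<close>-th one leave at time
  \<open>T + \<nu>C + j (\<pi> + \<nu>C)\<close> is feasible for every number of shuttles. If \<open>loads\<close> departures can carry
  the whole demand, the following is a bound on its delays.\<close>

definition naive_delay :: "service \<Rightarrow> nat \<Rightarrow> real" where
  "naive_delay P loads =
     period P + loading P * capacity P + real loads * (return_time P + loading P * capacity P)"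

text \<open>A date by which every loaded departure of a solution that is not worse than the naive one has
  taken place; the summand \<open>\<pi>\<close> makes the inequality strict.\<close>

definition last_departure :: "service \<Rightarrow> nat \<Rightarrow> real" where
  "last_departure P loads = period P + naive_delay P loads + return_time P"

text \<open>Where the rounded departure times end. Each of the \<open>rounds\<close> trips of a shuttle contributes
  \<open>\<pi>\<close> for departures of empty shuttles after the last loaded one and at most \<open>\<pi> + \<nu>C\<close> of rounding
  errors, and \<open>T + \<nu>C\<close> bounds the initial shift. This is independent of \<open>M\<close> and of the unknown
  Lipschitz constant, hence computable by the program.\<close>

definition last_instant :: "service \<Rightarrow> nat \<Rightarrow> nat \<Rightarrow> real" where
  "last_instant P loads rounds =
     last_departure P loads + period P + loading P * capacity P + 2 * return_time P
       + real rounds * (2 * return_time P + loading P * capacity P)"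

text \<open>The numbers \<open>loads\<close>, \<open>rounds\<close> and \<open>ticks\<close> depend neither on \<open>S\<close> nor on \<open>M\<close>: full loads
  in the total demand, trips of one shuttle, and units \<open>\<pi>\<close> of the time axis.\<close>

locale shuttle_grid =
  fixes P :: service and S M loads rounds ticks :: nat
  assumes valid: "valid_service P"
    and return_pos: "return_time P > 0"
    and S: "1 \<le> S" and M: "1 \<le> M"
    and loads: "total_demand P \<le> real loads * capacity P"
    and rounds: "last_departure P loads \<le> real rounds * return_time P"
    and ticks: "last_instant P loads rounds \<le> real ticks * return_time P"
begin

lemma last_bounds: "0 < last_departure P loads" "0 < last_instant P loads rounds"
proof -
  note P = valid_serviceD(1,2,3)[OF valid]
  have "0 \<le> loading P * capacity P" using P by simp
  moreover have "0 \<le> real b * (return_time P + loading P * capacity P)"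
    "0 \<le> real b * (2 * return_time P + loading P * capacity P)" for b
    using P return_pos by simp_all
  ultimately show "0 < last_departure P loads" "0 < last_instant P loads rounds"
    unfolding last_instant_def last_departure_def naive_delay_def
    using P return_pos by (smt (verit))+
qed

lemma rounds_pos: "1 \<le> rounds" and ticks_pos: "1 \<le> ticks"
  using last_bounds rounds ticks by (auto intro: ccontr simp: not_le)

definition levels :: nat where "levels = M * loads + 1"
definition instants :: nat where "instants = M * ticks"
definition tail_weight :: nat where "tail_weight = instants ^ (S - 1)"
definition horizon :: nat where "horizon = S * rounds"
definition actions :: nat where "actions = instants * levels"
definition codes :: nat where "codes = tail_weight * instants * levels"

text \<open>The step \<open>C / M\<close> divides the capacity, so that rounding up does not violate the latter.\<close>

definition level :: "nat \<Rightarrow> real" where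
  "level k = min (total_demand P) (real k * (capacity P / real M))"

text \<open>Instants start at \<open>-\<pi>\<close>. A fictitious departure at instant \<open>0\<close> returns before time \<open>0\<close>, so
  filling the window of past departures with zeros expresses that all shuttles are available.\<close>

definition instant :: "nat \<Rightarrow> real" where
  "instant l = real l * (return_time P / real M) - return_time P"

text \<open>Larger than any delay on the grid; it stands for infeasibility.\<close>

definition big :: real where "big = real ticks * return_time P"

text \<open>A state \<open>c\<close> consists of the digits of a window \<open>w\<close> of \<open>S\<close> past instants, most recent one
  last, followed by the current level. An action \<open>a\<close> consists of the instant and the resulting level
  of the next departure. The conditions are the negated tests of the program.\<close>

definition allowed :: "nat \<Rightarrow> nat \<Rightarrow> bool" where
  "allowed c a \<longleftrightarrow>
     (let k = c mod levels; w = c div levels; l' = a div levels; k' = a mod levels;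
          x = level k' - level k
      in \<not> x < 0 \<and> \<not> capacity P < x \<and> \<not> l' < w mod instants \<and>
         \<not> instant l' < taubar P (level k') + loading P * x \<and>
         \<not> instant l' < instant (w div tail_weight) + return_time P + loading P * x)"

definition successor :: "nat \<Rightarrow> nat \<Rightarrow> nat" where
  "successor c a = ((c div levels) mod tail_weight * instants + a div levels) * levels + a mod levels"

text \<open>The largest delay if the state \<open>c\<close> is left by \<open>a\<close> and \<open>f\<close> evaluates the remainder. An
  empty departure has no delay.\<close>

definition through :: "(nat \<Rightarrow> real) \<Rightarrow> nat \<Rightarrow> nat \<Rightarrow> real" where
  "through f c a =
     (let k = c mod levels; k' = a mod levels; v = f (successor c a);
          e = instant (a div levels) - tau P (level k)
      in if level k < level k' \<and> v < e then e else v)"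

text \<open>The minimum and a minimiser over the first actions, in the order in which the program scans
  them.\<close>

primrec best :: "(nat \<Rightarrow> real) \<Rightarrow> nat \<Rightarrow> nat \<Rightarrow> real \<times> nat" where
  "best f c 0 = (big, 0)"
| "best f c (Suc a) =
     (if allowed c a \<and> through f c a < fst (best f c a) then (through f c a, a) else best f c a)"

text \<open>Least possible value of the largest delay when \<open>n\<close> departures remain in state \<open>c\<close>.
  Value \<open>0\<close> at the end is harmless, since a delay is never negative.\<close>

primrec wait :: "nat \<Rightarrow> nat \<Rightarrow> real" where
  "wait 0 c = (if level (c mod levels) < total_demand P then big else 0)"
| "wait (Suc n) c = fst (best (wait n) c actions)"

lemma pos [simp]:
  "0 < levels" "0 < instants" "0 < tail_weight" "0 < actions" "0 < codes" "0 < horizon" "0 < M" "0 < S"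
  using S M rounds_pos ticks_pos
  by (auto simp: levels_def instants_def tail_weight_def actions_def codes_def horizon_def)

lemma M_pos [simp]: "0 < real M" using M by simp

lemma big_eq: "big = real instants * (return_time P / real M)"
  using M by (simp add: big_def instants_def)

lemma big_pos: "return_time P \<le> big" "0 < big"
  using ticks_pos return_pos by (auto simp: big_def)

lemma power_eq: "tail_weight * instants = instants ^ S"
  unfolding tail_weight_def using S by (metis Suc_diff_1 less_eq_Suc_le One_nat_def power_Suc2)

lemma best_le: "a < i \<Longrightarrow> allowed c a \<Longrightarrow> fst (best f c i) \<le> through f c a"
  by (induction i) (auto simp: less_Suc_eq)

lemma best_attained:
  "fst (best f c i) < big \<Longrightarrow>
    snd (best f c i) < i \<and> allowed c (snd (best f c i)) \<and> fst (best f c i) = through f c (snd (best f c i))"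
  by (induction i) (auto simp: less_Suc_eq)

lemma best_less: "0 < i \<Longrightarrow> snd (best f c i) < i"
proof (induction i)
  case (Suc i)
  then show ?case by (cases i) (auto simp: less_Suc_eq)
qed simp

lemma level_zero [simp]: "level 0 = 0"
  using valid_serviceD(7)[OF valid] by (simp add: level_def)

lemma level_bounds: "0 \<le> level k" "level k \<le> total_demand P"
  using valid_serviceD(1,7)[OF valid] M by (auto simp: level_def)

lemma action_digits:
  assumes "a < actions"
  shows "a div levels < instants" "a mod levels < levels"
  using assms by (auto simp: actions_def less_mult_imp_div_less)

text \<open>The truncated subtraction \<open>j - i\<close> makes \<open>l 0 = 0\<close> fill the window at the beginning.\<close>

definition window :: "(nat \<Rightarrow> nat) \<Rightarrow> nat \<Rightarrow> nat" where
  "window l j = (\<Sum>i<S. l (j - i) * instants ^ i)"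

definition code :: "(nat \<Rightarrow> nat) \<Rightarrow> (nat \<Rightarrow> nat) \<Rightarrow> nat \<Rightarrow> nat" where
  "code l k j = window l j * levels + k j"

text \<open>Departure \<open>Suc j\<close> respects the constraints with respect to the previous ones. For
  \<open>Suc j \<le> S\<close>, the shuttle that comes back is the fictitious one that left at instant \<open>l 0 = 0\<close>.\<close>

definition departs :: "(nat \<Rightarrow> nat) \<Rightarrow> (nat \<Rightarrow> nat) \<Rightarrow> nat \<Rightarrow> bool" where
  "departs l k j \<longleftrightarrow>
     (let x = level (k (Suc j)) - level (k j); t = instant (l (Suc j))
      in 0 \<le> x \<and> x \<le> capacity P \<and> l j \<le> l (Suc j) \<and>
         taubar P (level (k (Suc j))) + loading P * x \<le> t \<and>
         instant (l (Suc j - S)) + return_time P + loading P * x \<le> t)"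

context
  fixes l k :: "nat \<Rightarrow> nat"
  assumes l_less: "\<And>i. l i < instants" and k_less: "\<And>i. k i < levels"
    and l_0: "l 0 = 0" and k_0: "k 0 = 0"
begin

lemma window_div: "window l j div tail_weight = l (Suc j - S)"
  and window_mod: "window l j mod tail_weight = (\<Sum>i<S - 1. l (j - i) * instants ^ i)"
proof -
  have *: "(\<Sum>i<S - 1. l (j - i) * instants ^ i) < tail_weight"
    unfolding tail_weight_def by (rule digits_less_power) (rule l_less)
  have "window l j = (\<Sum>i<Suc (S - 1). l (j - i) * instants ^ i)"
    using S by (simp add: window_def)
  also have "\<dots> = (\<Sum>i<S - 1. l (j - i) * instants ^ i) + l (j - (S - 1)) * instants ^ (S - 1)"
    by (rule sum.lessThan_Suc)
  also have "j - (S - 1) = Suc j - S" using S by simp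
  finally have "window l j = (\<Sum>i<S - 1. l (j - i) * instants ^ i) + l (Suc j - S) * tail_weight"
    by (simp only: tail_weight_def)
  with * show "window l j div tail_weight = l (Suc j - S)"
    "window l j mod tail_weight = (\<Sum>i<S - 1. l (j - i) * instants ^ i)"
    by auto
qed

lemma window_shift: "window l j = (\<Sum>i<S - 1. l (j - 1 - i) * instants ^ i) * instants + l j"
proof -
  have "window l j = (\<Sum>i<Suc (S - 1). l (j - i) * instants ^ i)"
    using S by (simp add: window_def)
  also have "\<dots> = l j + (\<Sum>i<S - 1. l (j - Suc i) * instants ^ Suc i)"
    by (subst sum.lessThan_Suc_shift) simp
  finally show ?thesis by (simp add: sum_distrib_left mult_ac)
qed

lemma window_last: "window l j mod instants = l j"
  using l_less[of j] by (subst window_shift) simp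

lemma window_0: "window l 0 = 0"
  by (simp add: window_def l_0)

lemma code_0: "code l k 0 = 0"
  by (simp add: code_def window_0 k_0)

lemma code_digits: "code l k j div levels = window l j" "code l k j mod levels = k j"
  using k_less[of j] by (auto simp: code_def)

lemma action_of_digits:
  "(l i * levels + k i) div levels = l i" "(l i * levels + k i) mod levels = k i"
  "l i * levels + k i < actions"
proof -
  have "l i * levels + k i < Suc (l i) * levels" using k_less[of i] by simp
  also have "\<dots> \<le> instants * levels" using l_less[of i] by (intro mult_right_mono) auto
  finally show "l i * levels + k i < actions" by (simp add: actions_def)
qed (use k_less[of i] in auto)

lemma successor_code: "successor (code l k j) (l (Suc j) * levels + k (Suc j)) = code l k (Suc j)"
  unfolding successor_def code_digits action_of_digits window_mod
  by (simp add: code_def window_shift[of "Suc j"])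

lemma allowed_code: "allowed (code l k j) (l (Suc j) * levels + k (Suc j)) \<longleftrightarrow> departs l k j"
  unfolding allowed_def departs_def Let_def code_digits action_of_digits window_last window_div
  by (auto simp: not_less)

lemma through_code_le:
  assumes "f (code l k (Suc j)) \<le> G"
    and "level (k j) < level (k (Suc j)) \<Longrightarrow> instant (l (Suc j)) - tau P (level (k j)) \<le> G"
  shows "through f (code l k j) (l (Suc j) * levels + k (Suc j)) \<le> G"
  using assms unfolding through_def Let_def successor_code code_digits action_of_digits by auto

text \<open>The values are lower bounds: every schedule on the grid is among the paths that the recursion
  minimises over.\<close>

lemma wait_le:
  assumes "\<And>j. j < horizon \<Longrightarrow> departs l k j" "level (k horizon) = total_demand P" "0 \<le> G"
    and "\<And>j. j < horizon \<Longrightarrow> level (k j) < level (k (Suc j)) \<Longrightarrow>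
      instant (l (Suc j)) - tau P (level (k j)) \<le> G"
    and "n \<le> horizon"
  shows "wait n (code l k (horizon - n)) \<le> G"
  using \<open>n \<le> horizon\<close>
proof (induction n)
  case 0
  then show ?case using assms(2,3) by (simp add: code_digits)
next
  case (Suc n)
  define j where "j = horizon - Suc n"
  have j: "j < horizon" "Suc j = horizon - n" using Suc.prems by (auto simp: j_def)
  have "wait (Suc n) (code l k j) \<le> through (wait n) (code l k j) (l (Suc j) * levels + k (Suc j))"
    using assms(1)[OF j(1)] by (auto intro!: best_le action_of_digits simp: allowed_code)
  also have "\<dots> \<le> G"
    using Suc j assms(4)[OF j(1)] by (intro through_code_le) auto
  finally show ?case by (simp add: j_def)
qed

end

text \<open>The states met when minimising actions are followed from the initial state \<open>0\<close>.\<close>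

primrec visited :: "nat \<Rightarrow> nat" where
  "visited 0 = 0"
| "visited (Suc j) =
     successor (visited j) (snd (best (wait (horizon - Suc j)) (visited j) actions))"

definition chosen :: "nat \<Rightarrow> nat" where
  "chosen j = snd (best (wait (horizon - Suc j)) (visited j) actions)"

definition chosen_instant :: "nat \<Rightarrow> nat" where
  "chosen_instant j = (if j = 0 then 0 else chosen (j - 1) div levels)"

definition chosen_level :: "nat \<Rightarrow> nat" where
  "chosen_level j = (if j = 0 then 0 else chosen (j - 1) mod levels)"

lemma chosen_digits:
  "chosen_instant j < instants" "chosen_level j < levels"
  "chosen_instant 0 = 0" "chosen_level 0 = 0"
  "chosen j = chosen_instant (Suc j) * levels + chosen_level (Suc j)"
proof -
  have less: "chosen i < actions" for i unfolding chosen_def by (rule best_less) simp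
  show "chosen_instant j < instants" "chosen_level j < levels"
    using action_digits[OF less[of "j - 1"]] by (auto simp: chosen_instant_def chosen_level_def)
  show "chosen_instant 0 = 0" "chosen_level 0 = 0"
    "chosen j = chosen_instant (Suc j) * levels + chosen_level (Suc j)"
    unfolding chosen_instant_def chosen_level_def by (simp_all only: div_mult_mod_eq if_True if_False diff_Suc_1 nat.distinct refl)
qed

text \<open>The states visited are those of the schedule formed by the chosen actions, so that what
  \<open>allowed\<close> and \<open>through\<close> say about codes becomes a statement about consecutive departures.\<close>

lemma visited_code: "visited j = code chosen_instant chosen_level j"
proof (induction j)
  case 0
  then show ?case using code_0[of chosen_instant chosen_level, OF chosen_digits(1) chosen_digits(2) chosen_digits(3) chosen_digits(4)] by simp
next
  case (Suc j)
  have "visited (Suc j) = successor (visited j) (chosen j)" by (simp add: chosen_def)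
  then show ?case
    unfolding Suc chosen_digits(5)[of j] using successor_code[of chosen_instant chosen_level, OF chosen_digits(1) chosen_digits(2) chosen_digits(3) chosen_digits(4)] by simp
qed

text \<open>The values are attained: as long as the value is below \<open>big\<close>, the chosen action is allowed and
  neither its own delay nor the value of the next state exceeds the value of the current one.\<close>

lemma wait_visited:
  assumes "wait horizon 0 < big" "j \<le> horizon"
  shows "wait (horizon - j) (visited j) \<le> wait horizon 0"
    and "j < horizon \<Longrightarrow> departs chosen_instant chosen_level j"
    and "j < horizon \<Longrightarrow> level (chosen_level j) < level (chosen_level (Suc j)) \<Longrightarrow>
      instant (chosen_instant (Suc j)) - tau P (level (chosen_level j)) \<le> wait horizon 0"
proof -
  have step: "departs chosen_instant chosen_level j \<and>
     wait (horizon - Suc j) (visited (Suc j)) \<le> wait horizon 0 \<and>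
     (level (chosen_level j) < level (chosen_level (Suc j)) \<longrightarrow>
       instant (chosen_instant (Suc j)) - tau P (level (chosen_level j)) \<le> wait horizon 0)"
    if j: "j < horizon" and le: "wait (horizon - j) (visited j) \<le> wait horizon 0" for j
  proof -
    let ?f = "wait (horizon - Suc j)" and ?L = chosen_instant and ?K = chosen_level
    note code = chosen_digits(1) chosen_digits(2) chosen_digits(3) chosen_digits(4)
    have *: "wait (horizon - j) (visited j) = fst (best ?f (visited j) actions)"
      using j by (metis Suc_diff_Suc wait.simps(2))
    then have "fst (best ?f (visited j) actions) < big" using le assms(1) by simp
    from best_attained[OF this] have att:
      "allowed (visited j) (chosen j)" "fst (best ?f (visited j) actions) = through ?f (visited j) (chosen j)"
      by (auto simp: chosen_def)
    have th: "through ?f (visited j) (chosen j) \<le> wait horizon 0" using att * le by simp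
    have dep: "departs chosen_instant chosen_level j"
      using att(1) allowed_code[of ?L ?K, OF code, of j] unfolding chosen_digits(5)[of j] visited_code by simp
    from th show ?thesis using dep
      unfolding through_def Let_def visited_code chosen_digits(5)[of j] successor_code[of ?L ?K, OF code]
        code_digits[of ?L ?K, OF code] action_of_digits[of ?L ?K, OF code]
      by (auto split: if_splits)
  qed
  have main: "wait (horizon - j) (visited j) \<le> wait horizon 0" if "j \<le> horizon" for j
    using that by (induction j) (use step in auto)
  show "wait (horizon - j) (visited j) \<le> wait horizon 0" using main assms(2) .
  show "departs chosen_instant chosen_level j" if "j < horizon"
    using step that main by simp
  show "instant (chosen_instant (Suc j)) - tau P (level (chosen_level j)) \<le> wait horizon 0"
    if "j < horizon" "level (chosen_level j) < level (chosen_level (Suc j))"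
    using step that main by simp
qed

text \<open>After the horizon, empty shuttles leave at intervals of \<open>\<pi>\<close>.\<close>

definition plan_y :: "nat \<Rightarrow> real" where
  "plan_y j = level (chosen_level (min j horizon))"

definition plan_d :: "nat \<Rightarrow> real" where
  "plan_d j = instant (chosen_instant (min j horizon)) + real (j - horizon) * return_time P"

lemma instant_mono: "i \<le> j \<Longrightarrow> instant i \<le> instant j"
  using return_pos by (simp add: instant_def divide_right_mono mult_right_mono)

lemma plan_correct:
  assumes "wait horizon 0 < big"
  shows "feasible_return P S plan_d plan_y" and "g_max P plan_d plan_y \<le> ereal (wait horizon 0)"
proof -
  note dep = wait_visited(2)[OF assms less_imp_le]
  let ?L = chosen_instant and ?K = chosen_level
  \<comment> \<open>A state of the last layer has a value below \<open>big\<close> only if everything has been carried.\<close>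
  have full: "level (?K horizon) = total_demand P"
  proof -
    have "wait 0 (visited horizon) < big" using wait_visited(1)[OF assms order_refl] assms by simp
    then have "\<not> level (?K horizon) < total_demand P"
      using code_digits(2)[of chosen_instant chosen_level, OF chosen_digits(1) chosen_digits(2) chosen_digits(3) chosen_digits(4)] by (auto simp: visited_code split: if_splits)
    then show ?thesis using level_bounds(2)[of "?K horizon"] by simp
  qed
  have D: "0 \<le> plan_y (Suc j) - plan_y j" "plan_y (Suc j) - plan_y j \<le> capacity P"
    "plan_d j \<le> plan_d (Suc j)"
    "taubar P (plan_y (Suc j)) + loading P * (plan_y (Suc j) - plan_y j) \<le> plan_d (Suc j)" for j
  proof -
    have "0 \<le> plan_y (Suc j) - plan_y j \<and> plan_y (Suc j) - plan_y j \<le> capacity P \<and>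
      plan_d j \<le> plan_d (Suc j) \<and>
      taubar P (plan_y (Suc j)) + loading P * (plan_y (Suc j) - plan_y j) \<le> plan_d (Suc j)"
    proof (cases "j < horizon")
      case True
      then have m: "min j horizon = j" "min (Suc j) horizon = Suc j" "j - horizon = 0" "Suc j - horizon = 0"
        by auto
      then show ?thesis using dep[OF True True] instant_mono[of "?L j" "?L (Suc j)"]
        unfolding departs_def Let_def plan_y_def plan_d_def by simp
    next
      case False
      then have m: "min j horizon = horizon" "min (Suc j) horizon = horizon"
        "real (Suc j - horizon) = real (j - horizon) + 1"
        by auto
      obtain h where h: "horizon = Suc h" using pos(6) by (cases horizon) auto
      have "0 \<le> loading P * (level (?K (Suc h)) - level (?K h))"
        using dep[of h] h valid_serviceD(3)[OF valid] unfolding departs_def Let_def by simp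
      moreover have "taubar P (level (?K (Suc h))) + loading P * (level (?K (Suc h)) - level (?K h)) \<le> instant (?L (Suc h))"
        using dep[of h] h unfolding departs_def Let_def by simp
      ultimately have "taubar P (level (?K horizon)) \<le> instant (?L horizon)" using h by simp
      moreover have "0 \<le> (real (j - horizon) + 1) * return_time P" using return_pos by simp
      ultimately have "taubar P (level (?K horizon)) \<le> instant (?L horizon) + (real (j - horizon) + 1) * return_time P"
        by linarith
      then show ?thesis using return_pos valid_serviceD(1)[OF valid] unfolding plan_y_def plan_d_def m
        by (auto simp: algebra_simps)
    qed
    then show "0 \<le> plan_y (Suc j) - plan_y j" "plan_y (Suc j) - plan_y j \<le> capacity P"
      "plan_d j \<le> plan_d (Suc j)"
      "taubar P (plan_y (Suc j)) + loading P * (plan_y (Suc j) - plan_y j) \<le> plan_d (Suc j)" by auto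
  qed
  have ret: "plan_d j + return_time P + loading P * (plan_y (j + S) - plan_y (j + S - 1)) \<le> plan_d (j + S)"
    if "1 \<le> j" for j
  proof (cases "j + S \<le> horizon")
    case True
    define i where "i = j + S - 1"
    have i: "Suc i = j + S" "i < horizon" "Suc i - S = j" using True S that by (auto simp: i_def)
    then have m: "min j horizon = j" "min (Suc i) horizon = Suc i" "min i horizon = i"
      "j - horizon = 0" "Suc i - horizon = 0" using True by auto
    have "instant (?L j) + return_time P + loading P * (level (?K (Suc i)) - level (?K i)) \<le> instant (?L (Suc i))"
      using dep[OF i(2) i(2)] unfolding departs_def Let_def i(3) by simp
    then show ?thesis unfolding i(1)[symmetric] plan_y_def plan_d_def diff_Suc_1 m by simp
  next
    case False
    then have m: "min (j + S) horizon = horizon" "min (j + S - 1) horizon = horizon" by auto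
    have "real (j - horizon) + 1 \<le> real (j + S - horizon)" using False S by linarith
    then have "(real (j - horizon) + 1) * return_time P \<le> real (j + S - horizon) * return_time P"
      using return_pos by (intro mult_right_mono) auto
    moreover have "instant (?L (min j horizon)) \<le> instant (?L horizon)"
    proof -
      have "?L i \<le> ?L (i + n)" if "i + n \<le> horizon" for i n
        using that
      proof (induction n)
        case (Suc n)
        then have "?L (i + n) \<le> ?L (Suc (i + n))"
          using dep[of "i + n"] unfolding departs_def Let_def by simp
        then show ?case using Suc by simp
      qed simp
      from this[of "min j horizon" "horizon - min j horizon"] show ?thesis
        by (intro instant_mono) simp
    qed
    ultimately show ?thesis unfolding plan_y_def plan_d_def m by (simp add: algebra_simps)
  qed
  have y0: "plan_y 0 = 0" by (simp add: plan_y_def chosen_digits(4))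
  have dn: "0 \<le> plan_d (Suc j)" for j
  proof -
    have "0 \<le> taubar P (plan_y (Suc j))"
      using taubar_bounds(1)[OF valid level_bounds(2)] by (simp add: plan_y_def)
    moreover have "0 \<le> loading P * (plan_y (Suc j) - plan_y j)"
      using D(1)[of j] valid_serviceD(3)[OF valid] by simp
    ultimately show ?thesis using D(4)[of j] by linarith
  qed
  have lim: "plan_y \<longlonglongrightarrow> total_demand P"
  proof (rule tendsto_eventually)
    show "\<forall>\<^sub>F j in sequentially. plan_y j = total_demand P"
      by (rule eventually_sequentiallyI[of horizon]) (simp add: plan_y_def full min_absorb2)
  qed
  have D1: "plan_y j \<le> plan_y (Suc j)" for j using D(1)[of j] by simp
  show "feasible_return P S plan_d plan_y"
    by (intro feasible_returnI y0 dn lim ret D D1)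
  show "g_max P plan_d plan_y \<le> ereal (wait horizon 0)"
    unfolding g_max_def
  proof (rule SUP_least)
    fix j assume "j \<in> {j. j \<ge> 1 \<and> plan_y j > plan_y (j - 1)}"
    then obtain i where i: "j = Suc i" "plan_y i < plan_y (Suc i)" by (cases j) auto
    then have "i < horizon" by (cases "i < horizon") (auto simp: plan_y_def min_absorb2)
    moreover from this i have "level (?K i) < level (?K (Suc i))" by (simp add: plan_y_def)
    ultimately have "instant (?L (Suc i)) - tau P (level (?K i)) \<le> wait horizon 0"
      by (intro wait_visited(3)[OF assms]) auto
    then show "ereal (plan_d j - tau P (plan_y (j - 1))) \<le> ereal (wait horizon 0)"
      using \<open>i < horizon\<close> i by (simp add: plan_d_def plan_y_def)
  qed
qed

end

section \<open>Rounding a solution to the grid\<close>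

context shuttle_grid
begin

text \<open>The loads are rounded up to levels. The departure \<open>j\<close>, made by a shuttle that has completed
  \<open>q j\<close> trips, is delayed by \<open>\<delta> + q j * \<epsilon>\<close> and rounded up to an instant. Here \<open>\<delta>\<close> compensates for
  the new values of \<open>taubar\<close> and of the loading time; it is common to all departures and thus cancels
  out in the return constraint. In the latter only the loading time and the rounding of the preceding
  trip have to be compensated, which is what one \<open>\<epsilon>\<close> achieves. The number of trips is at most
  \<open>rounds\<close>, so that all errors are of order \<open>1 / M\<close>.\<close>

lemma round_departures:
  assumes feas: "feasible_return P S d y"
    and delay: "\<And>j. y j < y (Suc j) \<Longrightarrow> d (Suc j) - tau P (y j) \<le> g"
    and g: "0 \<le> g" "g \<le> naive_delay P loads"
    and b: "0 < b"
    and growth: "\<And>s t. 0 \<le> s \<Longrightarrow> s \<le> t \<Longrightarrow> t \<le> period P \<Longrightarrow>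
      demand P s + b * (t - s) \<le> demand P t"
  shows "wait horizon 0 < big"
    and "wait horizon 0 \<le> g + (loading P * capacity P + capacity P / b
       + real rounds * (return_time P + loading P * capacity P) + return_time P) / real M"
proof -
  note P = valid_serviceD(1,2,3,7)[OF valid] return_pos
  let ?Q = "total_demand P" and ?C = "capacity P" and ?T = "period P"
  let ?v = "loading P" and ?r = "return_time P"
  define h \<eta> where "h = ?C / real M" and "\<eta> = ?r / real M"
  have h: "0 < h" "h \<le> ?C" "real M * h = ?C"
    using P M by (auto simp: h_def field_simps)
  have \<eta>: "0 < \<eta>" "\<eta> \<le> ?r" "real M * \<eta> = ?r"
    using P M by (auto simp: \<eta>_def field_simps)
  have vh: "0 \<le> ?v * h" "?v * h \<le> ?v * ?C" using P h by (auto intro: mult_left_mono)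

  have y0: "y 0 = 0" and ymono: "\<And>j. y j \<le> y (Suc j)" and lim: "y \<longlonglongrightarrow> ?Q"
    and ycap: "\<And>j. y (Suc j) - y j \<le> ?C" and dmono: "\<And>j. d (Suc j) \<le> d (Suc (Suc j))"
    and d0: "\<And>j. 0 \<le> d (Suc j)"
    and load: "\<And>j. taubar P (y (Suc j)) + ?v * (y (Suc j) - y j) \<le> d (Suc j)"
    and ret: "\<And>j. d (Suc j) + ?r + ?v * (y (Suc j + S) - y (j + S)) \<le> d (Suc j + S)"
    using feas unfolding feasible_return_Suc by simp_all
  have inc: "incseq y" using ymono by (rule incseq_SucI)
  have yQ: "y j \<le> ?Q" for j using incseq_le[OF inc lim] .
  have ynn: "0 \<le> y j" for j using incseqD[OF inc, of 0 j] y0 by simp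

  define q where "q j = (j - 1) div S" for j
  \<comment> \<open>Empty shuttles may leave arbitrarily late. Departures are therefore capped by a bound that exceeds
    all loaded departures and grows by \<open>\<pi>\<close> from one trip to the next, as the return constraint demands.\<close>
  define cap where "cap j = last_departure P loads + real (q j) * ?r" for j
  define dh where "dh j = min (d j) (cap j)" for j
  have q_Suc: "q j \<le> q (Suc j)" for j unfolding q_def by (intro div_le_mono) simp
  have q_S: "q (Suc j + S) = Suc (q (Suc j))" for j using S by (simp add: q_def)
  have q_le: "q j \<le> rounds" if "j \<le> horizon" for j
  proof -
    have "q j \<le> horizon div S" unfolding q_def using that by (intro div_le_mono) simp
    then show ?thesis using S by (simp add: horizon_def)
  qed
  have loaded: "d (Suc j) \<le> last_departure P loads - ?r" if "y j < y (Suc j)" for j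
    using delay[OF that] g tau_bounds(2)[OF valid, of "y j"] by (simp add: last_departure_def)

  have dq: "real (q (Suc j)) * ?r \<le> d (Suc j)" for j
  proof (induction j rule: less_induct)
    case (less j)
    show ?case
    proof (cases "j < S")
      case True
      then show ?thesis using d0 by (simp add: q_def)
    next
      case False
      then obtain i where i: "j = i + S" by (metis add.commute le_Suc_ex not_less)
      have "real (q (Suc i)) * ?r \<le> d (Suc i)" using less[of i] i S by simp
      moreover have "0 \<le> ?v * (y (Suc i + S) - y (i + S))" using P ymono[of "i + S"] by simp
      ultimately have "real (Suc (q (Suc i))) * ?r \<le> d (Suc i + S)"
        using ret[of i] by (simp add: algebra_simps)
      then show ?thesis using q_S[of i] i by simp
    qed
  qed
  \<comment> \<open>A loaded departure after the horizon would belong to a trip that starts too late.\<close>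
  have full: "y horizon = ?Q"
  proof -
    have step: "y (Suc j) = y j" if "horizon \<le> j" for j
    proof (rule ccontr)
      assume "y (Suc j) \<noteq> y j"
      then have "y j < y (Suc j)" using ymono[of j] by simp
      from loaded[OF this] have "d (Suc j) < real rounds * ?r" using rounds P by simp
      moreover have "rounds \<le> q (Suc j)" using that div_le_mono[of horizon j S] S
        by (simp add: q_def horizon_def)
      then have "real rounds * ?r \<le> real (q (Suc j)) * ?r" using P by (intro mult_right_mono) auto
      ultimately show False using dq[of j] by linarith
    qed
    have "y (horizon + n) = y horizon" for n by (induction n) (use step in auto)
    then have "y j = y horizon" if "horizon \<le> j" for j using that by (metis le_iff_add)
    then have "y \<longlonglongrightarrow> y horizon" by (intro tendsto_eventually eventually_sequentiallyI)
    then show ?thesis using lim LIMSEQ_unique by blast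
  qed

  have dh_mono: "dh (Suc j) \<le> dh (Suc (Suc j))" for j
    using dmono[of j] q_Suc[of "Suc j"] P unfolding dh_def cap_def
    by (intro min.mono) (auto intro!: mult_right_mono)
  have dh_load: "taubar P (y (Suc j)) + ?v * (y (Suc j) - y j) \<le> dh (Suc j)" for j
  proof -
    have "last_departure P loads \<le> cap (Suc j)" using P by (simp add: cap_def)
    moreover have "?T \<le> last_departure P loads"
      using g P by (simp add: last_departure_def)
    moreover have "taubar P (y (Suc j)) \<le> ?T" using taubar_bounds(2)[OF valid yQ] .
    ultimately show ?thesis
      using load[of j] loaded[of j] ymono[of j] P by (cases "y j < y (Suc j)") (auto simp: dh_def)
  qed
  have dh_ret: "dh (Suc j) + ?r + ?v * (y (Suc j + S) - y (j + S)) \<le> dh (Suc j + S)" for j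
  proof -
    have c: "cap (Suc j + S) = cap (Suc j) + ?r" unfolding cap_def q_S by (simp add: algebra_simps)
    have "last_departure P loads \<le> cap (Suc j + S)" using P by (simp add: cap_def)
    then show ?thesis
      using ret[of j] loaded[of "j + S"] ymono[of "j + S"] P c
      by (cases "y (j + S) < y (Suc j + S)") (auto simp: dh_def)
  qed
  have dh0: "0 \<le> dh (Suc j)" for j
  proof -
    have "0 \<le> cap (Suc j)" using last_bounds P by (simp add: cap_def)
    then show ?thesis using d0 by (simp add: dh_def)
  qed

  define k where "k j = nat \<lceil>y j / h\<rceil>" for j
  have k: "real (k j) = real_of_int \<lceil>y j / h\<rceil>" for j
    using ynn[of j] h by (simp add: k_def)
  have k_ge: "y j \<le> real (k j) * h" for j
    using mult_right_mono[OF le_of_int_ceiling[of "y j / h"], of h] h by (simp add: k)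
  have k_lt: "real (k j) * h < y j + h" for j
  proof -
    have "real (k j) < y j / h + 1" unfolding k by linarith
    then have "real (k j) * h < (y j / h + 1) * h" using h by (intro mult_strict_right_mono)
    then show ?thesis using h by (simp add: algebra_simps)
  qed
  have k_less: "k j < levels" for j
  proof -
    have "y j \<le> real loads * (real M * h)" using yQ[of j] loads h by simp
    then have "y j / h \<le> real (M * loads)" using h by (simp add: field_simps)
    then have "\<lceil>y j / h\<rceil> \<le> int (M * loads)" by (simp add: ceiling_le_iff)
    then show ?thesis by (simp add: k_def levels_def nat_le_iff less_Suc_eq_le)
  qed
  have k0: "k 0 = 0" by (simp add: k_def y0)
  have lev: "level (k j) = min ?Q (real (k j) * h)" for j by (simp add: level_def h_def)
  have lev_ge: "y j \<le> level (k j)" and lev_le: "level (k j) \<le> y j + h" for j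
    using k_ge[of j] k_lt[of j] yQ[of j] by (auto simp: lev)
  have lev_mono: "level (k j) \<le> level (k (Suc j))" for j
  proof -
    have "k j \<le> k (Suc j)"
      unfolding k_def using ymono[of j] h by (intro nat_mono ceiling_mono divide_right_mono) auto
    then show ?thesis unfolding lev using h by (intro min.mono mult_right_mono) auto
  qed
  \<comment> \<open>This is where \<open>C = M * h\<close> matters: a ceiling commutes with adding the integer \<open>M\<close>.\<close>
  have lev_cap: "level (k (Suc j)) - level (k j) \<le> ?C" for j
  proof -
    have "y (Suc j) / h \<le> y j / h + real M" using ycap[of j] h by (simp add: field_simps)
    then have "\<lceil>y (Suc j) / h\<rceil> \<le> \<lceil>y j / h + of_int (int M)\<rceil>" by (intro ceiling_mono) simp
    then have "real (k (Suc j)) \<le> real (k j) + real M" unfolding k ceiling_add_of_int by linarith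
    then have "real (k (Suc j)) * h \<le> (real (k j) + real M) * h" using h by (intro mult_right_mono) auto
    then have "real (k (Suc j)) * h \<le> real (k j) * h + ?C" using h by (simp add: algebra_simps)
    then show ?thesis unfolding lev using P by (auto simp: min_def)
  qed
  have lev_full: "level (k horizon) = ?Q"
    using lev_ge[of horizon] full level_bounds(2)[of "k horizon"] by simp

  \<comment> \<open>The minimum with the period keeps \<open>\<delta>\<close> below a bound that does not involve \<open>b\<close>.\<close>
  define \<delta> where "\<delta> = ?v * h + min ?T (h / b)"
  define \<epsilon> where "\<epsilon> = \<eta> + ?v * h"
  have \<delta>: "0 \<le> \<delta>" "\<delta> \<le> ?v * ?C + ?T" "\<delta> \<le> ?v * h + h / b"
    using P vh h b by (auto simp: \<delta>_def min_def)
  have \<epsilon>: "0 \<le> \<epsilon>" "\<epsilon> \<le> ?r + ?v * ?C" using P vh \<eta> by (auto simp: \<epsilon>_def)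
  have load_round: "taubar P (level (k (Suc j))) + ?v * (level (k (Suc j)) - level (k j))
      \<le> taubar P (y (Suc j)) + ?v * (y (Suc j) - y j) + \<delta>" for j
  proof -
    have "taubar P (level (k (Suc j))) \<le> taubar P (y (Suc j)) + (level (k (Suc j)) - y (Suc j)) / b"
      by (rule taubar_lipschitz[OF valid b growth lev_ge level_bounds(2)])
    also have "\<dots> \<le> taubar P (y (Suc j)) + h / b"
      using lev_le[of "Suc j"] b by (simp add: divide_right_mono)
    finally have "taubar P (level (k (Suc j))) \<le> taubar P (y (Suc j)) + min ?T (h / b)"
      using taubar_bounds(2)[OF valid level_bounds(2)[of "k (Suc j)"]]
        taubar_bounds(1)[OF valid yQ[of "Suc j"]] by (simp add: min_def)
    moreover have "?v * (level (k (Suc j)) - level (k j)) \<le> ?v * ((y (Suc j) - y j) + h)"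
      using lev_le[of "Suc j"] lev_ge[of j] P by (intro mult_left_mono) auto
    ultimately show ?thesis by (simp add: \<delta>_def algebra_simps)
  qed
  have gain_round: "?v * (level (k (Suc j)) - level (k j)) \<le> ?v * (y (Suc j) - y j) + ?v * h" for j
  proof -
    have "?v * (level (k (Suc j)) - level (k j)) \<le> ?v * ((y (Suc j) - y j) + h)"
      using lev_le[of "Suc j"] lev_ge[of j] P by (intro mult_left_mono) auto
    then show ?thesis by (simp add: algebra_simps)
  qed

  define v where "v j = dh j + \<delta> + real (q j) * \<epsilon>" for j
  \<comment> \<open>Beyond the horizon the digits only have to be valid.\<close>
  define l where "l j = (if j = 0 \<or> horizon < j then 0 else nat \<lceil>(v j + ?r) / \<eta>\<rceil>)" for j
  have inst: "instant n = real n * \<eta> - ?r" for n by (simp add: instant_def \<eta>_def)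
  have v_mono: "v (Suc j) \<le> v (Suc (Suc j))" for j
    unfolding v_def using dh_mono[of j] q_Suc[of "Suc j"] \<epsilon>
    by (intro add_mono mult_right_mono) auto
  have v0: "0 \<le> v (Suc j)" for j using dh0 \<delta> \<epsilon> by (simp add: v_def)
  have inst_ge: "v (Suc j) \<le> instant (l (Suc j))" and inst_lt: "instant (l (Suc j)) < v (Suc j) + \<eta>"
    if "j < horizon" for j
  proof -
    have "0 \<le> (v (Suc j) + ?r) / \<eta>" using v0[of j] P \<eta> by simp
    then have l: "real (l (Suc j)) = real_of_int \<lceil>(v (Suc j) + ?r) / \<eta>\<rceil>"
      using that by (simp add: l_def)
    have "(v (Suc j) + ?r) / \<eta> * \<eta> \<le> real (l (Suc j)) * \<eta>"
      unfolding l using \<eta> by (intro mult_right_mono) auto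
    then show "v (Suc j) \<le> instant (l (Suc j))" using \<eta> by (simp add: inst)
    have "real (l (Suc j)) < (v (Suc j) + ?r) / \<eta> + 1" unfolding l by linarith
    then have "real (l (Suc j)) * \<eta> < ((v (Suc j) + ?r) / \<eta> + 1) * \<eta>"
      using \<eta> by (intro mult_strict_right_mono) auto
    also have "((v (Suc j) + ?r) / \<eta> + 1) * \<eta> = v (Suc j) + ?r + \<eta>"
      using \<eta> by (simp only: distrib_right) simp
    finally show "instant (l (Suc j)) < v (Suc j) + \<eta>" by (simp add: inst)
  qed
  have v_le: "v (Suc j) \<le> last_departure P loads + real rounds * ?r + ?v * ?C + ?T + real rounds * (?r + ?v * ?C)"
    if "j < horizon" for j
  proof -
    have q: "real (q (Suc j)) \<le> real rounds" using q_le[of "Suc j"] that by simp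
    have "dh (Suc j) \<le> last_departure P loads + real rounds * ?r"
      using mult_right_mono[OF q, of ?r] P unfolding dh_def cap_def by linarith
    moreover have "real (q (Suc j)) * \<epsilon> \<le> real rounds * (?r + ?v * ?C)"
      using q \<epsilon> by (intro mult_mono) auto
    ultimately show ?thesis using \<delta> by (simp add: v_def)
  qed
  have l_less: "l j < instants" for j
  proof (cases "j = 0 \<or> horizon < j")
    case False
    then obtain i where i: "j = Suc i" "i < horizon" by (cases j) auto
    have "real (l j) * \<eta> < last_instant P loads rounds"
      using inst_lt[OF i(2)] v_le[OF i(2)] \<eta> unfolding i(1) inst
      by (simp add: last_instant_def algebra_simps)
    also have "\<dots> \<le> real instants * \<eta>" using ticks M by (simp add: instants_def \<eta>_def)
    finally show ?thesis using \<eta> by simp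
  qed (use pos(2) in \<open>auto simp: l_def\<close>)
  have l0: "l 0 = 0" by (simp add: l_def)
  have code0: "code l k 0 = 0" using code_0[of l k, OF l_less k_less l0 k0] .

  have dep: "departs l k j" if j: "j < horizon" for j
    unfolding departs_def Let_def
  proof (intro conjI)
    show "0 \<le> level (k (Suc j)) - level (k j)" using lev_mono by simp
    then have vx: "0 \<le> ?v * (level (k (Suc j)) - level (k j))" using P by simp
    show "level (k (Suc j)) - level (k j) \<le> ?C" by (rule lev_cap)
    show "l j \<le> l (Suc j)"
    proof (cases j)
      case (Suc i)
      have "nat \<lceil>(v (Suc i) + ?r) / \<eta>\<rceil> \<le> nat \<lceil>(v (Suc (Suc i)) + ?r) / \<eta>\<rceil>"
        using v_mono[of i] \<eta> by (intro nat_mono ceiling_mono divide_right_mono) auto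
      then show ?thesis unfolding l_def using j Suc by simp
    qed (simp add: l0)
    have "0 \<le> real (q (Suc j)) * \<epsilon>" using \<epsilon> by simp
    then show load': "taubar P (level (k (Suc j))) + ?v * (level (k (Suc j)) - level (k j)) \<le> instant (l (Suc j))"
      using load_round[of j] dh_load[of j] inst_ge[OF j] unfolding v_def by linarith
    show "instant (l (Suc j - S)) + ?r + ?v * (level (k (Suc j)) - level (k j)) \<le> instant (l (Suc j))"
    proof (cases "S \<le> j")
      case False
      then have "instant (l (Suc j - S)) = - ?r" by (simp add: l0 inst)
      then show ?thesis using load' taubar_bounds(1)[OF valid level_bounds(2)[of "k (Suc j)"]] by simp
    next
      case True
      then obtain i where i: "j = i + S" by (metis add.commute le_Suc_ex)
      have e: "Suc j - S = Suc i" "i < horizon" using i j by auto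
      have "instant (l (Suc i)) + ?r + ?v * (level (k (Suc j)) - level (k j))
         \<le> dh (Suc i) + \<delta> + real (q (Suc i)) * \<epsilon> + \<eta> + ?r + ?v * (y (Suc i + S) - y (i + S)) + ?v * h"
        using inst_lt[OF e(2)] gain_round[of j] unfolding v_def by (simp add: i)
      also have "\<dots> \<le> dh (Suc i + S) + \<delta> + real (q (Suc i + S)) * \<epsilon>"
        using dh_ret[of i] unfolding q_S by (simp add: \<epsilon>_def algebra_simps)
      also have "\<dots> \<le> instant (l (Suc j))" using inst_ge[OF j] by (simp add: v_def i)
      finally show ?thesis unfolding e(1) .
    qed
  qed

  \<comment> \<open>The schedule obtained witnesses that the value is not \<open>big\<close>, whatever its delays are.\<close>
  have "wait horizon (code l k (horizon - horizon)) \<le> big - ?r"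
  proof (rule wait_le[of l k, OF l_less k_less l0 k0 dep lev_full])
    show "0 \<le> big - ?r" using big_pos by simp
    fix j
    have "Suc (l (Suc j)) \<le> instants" using l_less[of "Suc j"] by simp
    then have "real (l (Suc j)) * \<eta> \<le> real instants * \<eta>" using \<eta> by (intro mult_right_mono) auto
    then have "instant (l (Suc j)) \<le> big - ?r" by (simp add: inst big_eq \<eta>_def)
    then show "instant (l (Suc j)) - tau P (level (k j)) \<le> big - ?r"
      using tau_bounds(1)[OF valid, of "level (k j)"] by simp
  qed auto
  then show "wait horizon 0 < big" using P by (simp add: code0)

  define err where "err = (?v * ?C + ?C / b + real rounds * (?r + ?v * ?C) + ?r) / real M"
  have err: "err = ?v * h + h / b + real rounds * \<epsilon> + \<eta>"
    using M b by (simp add: err_def h_def \<eta>_def \<epsilon>_def field_simps)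
  have err0: "0 \<le> err" unfolding err using vh h b \<epsilon> \<eta> by simp
  have "wait horizon (code l k (horizon - horizon)) \<le> g + err"
  proof (rule wait_le[of l k, OF l_less k_less l0 k0 dep lev_full])
    show "0 \<le> g + err" using g err0 by simp
    fix j assume j: "j < horizon" and less: "level (k j) < level (k (Suc j))"
    have "y j < y (Suc j)"
      using less ymono[of j] by (cases "y j = y (Suc j)") (auto simp: k_def)
    from delay[OF this] have "d (Suc j) \<le> g + tau P (level (k j))"
      using tau_mono[OF valid lev_ge[of j]] by simp
    moreover have "real (q (Suc j)) * \<epsilon> \<le> real rounds * \<epsilon>"
      using q_le[of "Suc j"] j \<epsilon> by (intro mult_right_mono) auto
    moreover have "dh (Suc j) \<le> d (Suc j)" by (simp add: dh_def)
    ultimately show "instant (l (Suc j)) - tau P (level (k j)) \<le> g + err"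
      using inst_lt[OF j] \<delta>(3) unfolding v_def err by linarith
  qed auto
  then show "wait horizon 0 \<le> g + (?v * ?C + ?C / b + real rounds * (?r + ?v * ?C) + ?r) / real M"
    by (simp add: code0 err_def)
qed

text \<open>The departures are \<open>\<pi> + \<nu>C\<close> apart, which leaves enough time for a single shuttle.\<close>

lemma naive_solution:
  obtains d y where "feasible_return P S d y"
    and "\<And>j. y j < y (Suc j) \<Longrightarrow> d (Suc j) - tau P (y j) \<le> naive_delay P loads"
proof -
  note P = valid_serviceD(1,2,3,7)[OF valid] return_pos
  let ?Q = "total_demand P" and ?C = "capacity P" and ?T = "period P"
  let ?v = "loading P" and ?r = "return_time P"
  define y where "y j = min ?Q (real j * ?C)" for j
  define d where "d j = ?T + ?v * ?C + real j * (?r + ?v * ?C)" for j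
  have vC: "0 \<le> ?v * ?C" using P by simp
  have y: "0 \<le> y (Suc j) - y j" "y (Suc j) - y j \<le> ?C" "y j \<le> ?Q" for j
    using P by (auto simp: y_def min_def algebra_simps)
  have vx: "?v * (y (Suc j) - y j) \<le> ?v * ?C" for j using y P by (intro mult_left_mono) auto
  have step: "d j + ?r + ?v * ?C \<le> d (j + S)" for j
  proof -
    have "1 * (?r + ?v * ?C) \<le> real S * (?r + ?v * ?C)" using S P vC by (intro mult_right_mono) auto
    then show ?thesis by (simp add: d_def algebra_simps)
  qed
  have full: "y j = ?Q" if "loads \<le> j" for j
  proof -
    have "real loads * ?C \<le> real j * ?C" using that P by (intro mult_right_mono) auto
    then show ?thesis using loads by (simp add: y_def)
  qed
  have d0: "0 \<le> d j" for j using P vC by (simp add: d_def)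
  have "feasible_return P S d y"
  proof (rule feasible_returnI)
    show "y \<longlonglongrightarrow> ?Q" using full by (intro tendsto_eventually eventually_sequentiallyI[of loads])
    show "d j + ?r + ?v * (y (j + S) - y (j + S - 1)) \<le> d (j + S)" if "1 \<le> j" for j
      using step[of j] vx[of "j + S - 1"] S that by simp
    show "taubar P (y (Suc j)) + ?v * (y (Suc j) - y j) \<le> d (Suc j)" for j
    proof -
      have "0 \<le> real (Suc j) * (?r + ?v * ?C)" using P vC by simp
      then show ?thesis using vx[of j] taubar_bounds(2)[OF valid y(3)[of "Suc j"]]
        unfolding d_def by linarith
    qed
    show "y 0 = 0" using P by (simp add: y_def)
    show "0 \<le> d (Suc j)" for j by (rule d0)
    show "y (Suc j) - y j \<le> ?C" "y j \<le> y (Suc j)" for j using y[of j] by auto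
    show "d j \<le> d (Suc j)" for j using P vC by (simp add: d_def algebra_simps)
  qed
  moreover have "d (Suc j) - tau P (y j) \<le> naive_delay P loads" if "y j < y (Suc j)" for j
  proof -
    have "Suc j \<le> loads" using that full[of j] y(3)[of "Suc j"] by (cases "loads \<le> j") auto
    then have "real (Suc j) * (?r + ?v * ?C) \<le> real loads * (?r + ?v * ?C)"
      using P vC by (intro mult_right_mono) auto
    then show ?thesis using tau_bounds(1)[OF valid, of "y j"]
      unfolding d_def naive_delay_def by linarith
  qed
  ultimately show ?thesis using that by blast
qed

text \<open>Feasible solutions that are worse than the naive one need not fit into the grid; for them the
  comparison goes through the naive solution.\<close>

lemma plan_near_optimal:
  assumes b: "0 < b"
    and growth: "\<And>s t. 0 \<le> s \<Longrightarrow> s \<le> t \<Longrightarrow> t \<le> period P \<Longrightarrow>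
      demand P s + b * (t - s) \<le> demand P t"
  shows "feasible_return P S plan_d plan_y"
    and "g_max P plan_d plan_y \<le> OPT_return P S + ereal ((loading P * capacity P + capacity P / b
       + real rounds * (return_time P + loading P * capacity P) + return_time P) / real M)"
proof -
  note P = valid_serviceD(1,2,3,7)[OF valid] return_pos
  define err where "err = (loading P * capacity P + capacity P / b
       + real rounds * (return_time P + loading P * capacity P) + return_time P) / real M"
  have naive0: "0 \<le> naive_delay P loads"
    using P by (simp add: naive_delay_def)
  obtain dn yn where n: "feasible_return P S dn yn"
    "\<And>j. yn j < yn (Suc j) \<Longrightarrow> dn (Suc j) - tau P (yn j) \<le> naive_delay P loads"
    using naive_solution by blast
  note rn = round_departures[OF n naive0 order_refl b growth, folded err_def]
  note plan = plan_correct[OF rn(1)]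
  show "feasible_return P S plan_d plan_y" by (rule plan)
  have "ereal (wait horizon 0) - ereal err \<le> g_max P d y" if f: "feasible_return P S d y" for d y
  proof (cases "g_max P d y \<le> ereal (naive_delay P loads)")
    case False
    have "wait horizon 0 - err \<le> naive_delay P loads" using rn(2) by simp
    then have "ereal (wait horizon 0) - ereal err \<le> ereal (naive_delay P loads)" by simp
    also have "\<dots> \<le> g_max P d y" using False by simp
    finally show ?thesis .
  next
    case True
    have elem: "ereal (d (Suc j) - tau P (y j)) \<le> g_max P d y" if "y j < y (Suc j)" for j
      unfolding g_max_def using that by (intro SUP_upper2[of "Suc j"]) auto
    \<comment> \<open>Something has to be carried, and the delay of a loaded departure is nonnegative. Hence the
      objective value is a nonnegative real number.\<close>
    obtain i where i: "y i < y (Suc i)"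
    proof (rule ccontr)
      assume "\<not> thesis"
      then have "y (Suc i) = y i" for i
        using that f unfolding feasible_return_Suc by (metis order.not_eq_order_implies_strict)
      then have "y j = 0" for j
        using f by (induction j) (auto simp: feasible_return_Suc)
      then have "y \<longlonglongrightarrow> 0" by (intro tendsto_eventually) simp
      moreover have "y \<longlonglongrightarrow> total_demand P" using f by (simp add: feasible_return_Suc)
      ultimately have "total_demand P = 0" using LIMSEQ_unique by blast
      then show False using P by simp
    qed
    have "y (Suc i) \<le> total_demand P"
      using f incseq_le[of y] incseq_SucI[of y] unfolding feasible_return_Suc by simp
    from tau_le_taubar[OF valid i this] have "tau P (y i) \<le> taubar P (y (Suc i))" .
    moreover have "taubar P (y (Suc i)) + loading P * (y (Suc i) - y i) \<le> d (Suc i)"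
      using f unfolding feasible_return_Suc by simp
    moreover have "0 \<le> loading P * (y (Suc i) - y i)" using i P by simp
    ultimately have "0 \<le> d (Suc i) - tau P (y i)" by linarith
    then have "0 \<le> g_max P d y" using elem[OF i] by (metis dual_order.trans ereal_less_eq(5))
    with True obtain g where g: "g_max P d y = ereal g" "0 \<le> g" "g \<le> naive_delay P loads"
      by (cases "g_max P d y") auto
    have "d (Suc j) - tau P (y j) \<le> g" if "y j < y (Suc j)" for j
      using elem[OF that] g by simp
    from round_departures(2)[OF f this g(2,3) b growth, folded err_def]
    show ?thesis using g by simp
  qed
  then have "ereal (wait horizon 0) - ereal err \<le> OPT_return P S"
    unfolding OPT_return_def by (intro INF_greatest) auto
  then have "ereal (wait horizon 0) \<le> OPT_return P S + ereal err"
    by (cases "OPT_return P S") auto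
  then show "g_max P plan_d plan_y \<le> OPT_return P S + ereal err"
    using plan(2) by (rule order_trans[rotated])
qed

end

section \<open>Reasoning about running times\<close>

text \<open>Total correctness with the number of steps as an argument of the postcondition. The equations
  below compute it for code without loops.\<close>

definition wp :: "service \<Rightarrow> com \<Rightarrow> state \<Rightarrow> (nat \<Rightarrow> state \<Rightarrow> bool) \<Rightarrow> bool" where
  "wp P c s Q \<longleftrightarrow> (\<exists>n s'. exec P c s n s' \<and> Q n s')"

lemma wp_mono: "wp P c s Q \<Longrightarrow> (\<And>n s'. Q n s' \<Longrightarrow> R n s') \<Longrightarrow> wp P c s R"
  unfolding wp_def by blast

lemma wp_basic [simp]:
  "wp P Skip s Q \<longleftrightarrow> Q 1 s"
  "wp P (NSet a i e) s Q \<longleftrightarrow> Q 1 (set_nat a (nval i s) (nval e s) s)"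
  "wp P (RSet a i f) s Q \<longleftrightarrow> Q 1 (set_real a (nval i s) (rval P f s) s)"
  unfolding wp_def by (subst exec.simps, force)+

lemma wp_Seq: "wp P (Seq c c') s Q \<longleftrightarrow> wp P c s (\<lambda>n s'. wp P c' s' (\<lambda>m s''. Q (n + m) s''))"
  unfolding wp_def by (blast intro: exec.Seq elim: exec.cases[of P "Seq c c'"])

lemma wp_If:
  "wp P (If b c c') s Q \<longleftrightarrow>
     (if bval P b s then wp P c s (\<lambda>n. Q (Suc n)) else wp P c' s (\<lambda>n. Q (Suc n)))"
  unfolding wp_def by (subst exec.simps, auto)

text \<open>The invariant is indexed by the number of iterations already done, which is known in advance for
  all loops that follow.\<close>

lemma wp_While:
  assumes "I 0 s"
    and "\<And>i s. i < m \<Longrightarrow> I i s \<Longrightarrow> bval P b s \<and> wp P c s (\<lambda>n s'. n \<le> t \<and> I (Suc i) s')"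
    and "\<And>s. I m s \<Longrightarrow> \<not> bval P b s"
  shows "wp P (While b c) s (\<lambda>n s'. n \<le> 1 + m * (t + 1) \<and> I m s')"
proof -
  have "wp P (While b c) s (\<lambda>n s'. n \<le> 1 + (m - i) * (t + 1) \<and> I m s')" if "i \<le> m" "I i s" for i s
    using that
  proof (induction i arbitrary: s rule: inc_induct)
    case base
    then show ?case
      using assms(3)[OF base] exec.WhileFalse unfolding wp_def by (intro exI[of _ 1] exI[of _ s]) auto
  next
    case (step i)
    obtain n s' where body: "exec P c s n s'" "n \<le> t" "I (Suc i) s'" "bval P b s"
      using assms(2)[OF step(2,4)] unfolding wp_def by auto
    obtain n' s'' where rest: "exec P (While b c) s' n' s''" "n' \<le> 1 + (m - Suc i) * (t + 1)" "I m s''"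
      using step.IH[OF body(3)] unfolding wp_def by auto
    have "m - i = Suc (m - Suc i)" using step(2) by simp
    then have "Suc (n + n') \<le> 1 + (m - i) * (t + 1)" using body(2) rest(2) by simp
    then show ?case
      using exec.WhileTrue[OF body(4,1) rest(1)] rest(3) unfolding wp_def by blast
  qed
  from this[of 0 s] show ?thesis using assms(1) by simp
qed

abbreviation nvar :: "string \<Rightarrow> nexp" where "nvar a \<equiv> NGet a (NConst 0)"
abbreviation rvar :: "string \<Rightarrow> rexp" where "rvar a \<equiv> RGet a (NConst 0)"
abbreviation nset :: "string \<Rightarrow> nexp \<Rightarrow> com" where "nset a \<equiv> NSet a (NConst 0)"
abbreviation rset :: "string \<Rightarrow> rexp \<Rightarrow> com" where "rset a \<equiv> RSet a (NConst 0)"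

lemma state_simps [simp]:
  "nats (set_nat a i v s) = (nats s)(a := (nats s a)(i := v))" "reals (set_nat a i v s) = reals s"
  "reals (set_real a i x s) = (reals s)(a := (reals s a)(i := x))" "nats (set_real a i x s) = nats s"
  by (auto simp: set_nat_def set_real_def)

text \<open>The frame condition that postconditions carry. Arrays of naturals and of reals may have the same
  name; a name in \<open>X\<close> releases both.\<close>

definition unchanged :: "string set \<Rightarrow> state \<Rightarrow> state \<Rightarrow> bool" where
  "unchanged X s s' \<longleftrightarrow> (\<forall>a. a \<notin> X \<longrightarrow> nats s' a = nats s a \<and> reals s' a = reals s a)"

lemma unchanged_trans:
  "unchanged X s s' \<Longrightarrow> unchanged Y s' s'' \<Longrightarrow> X \<subseteq> Z \<Longrightarrow> Y \<subseteq> Z \<Longrightarrow> unchanged Z s s''"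
  unfolding unchanged_def by (metis subsetD)

lemma unchanged_set [intro]:
  "unchanged X s s' \<Longrightarrow> a \<in> X \<Longrightarrow> unchanged X s (set_nat a i v s')"
  "unchanged X s s' \<Longrightarrow> a \<in> X \<Longrightarrow> unchanged X s (set_real a i x s')"
  by (auto simp: unchanged_def)

lemma unchanged_refl [simp]: "unchanged X s s"
  by (simp add: unchanged_def)

lemma unchangedD:
  "unchanged X s s' \<Longrightarrow> a \<notin> X \<Longrightarrow> nats s' a = nats s a"
  "unchanged X s s' \<Longrightarrow> a \<notin> X \<Longrightarrow> reals s' a = reals s a"
  by (auto simp: unchanged_def)

definition for_loop :: "string \<Rightarrow> nexp \<Rightarrow> com \<Rightarrow> com" where
  "for_loop v e c =
     Seq (nset v (NConst 0))
       (While (NLess (nvar v) e) (Seq c (nset v (NAdd (nvar v) (NConst 1)))))"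

lemma wp_for_loop:
  assumes init: "I 0 (set_nat v 0 0 s)"
    and bound: "\<And>i s. I i s \<Longrightarrow> nats s v 0 = i \<and> nval e s = m"
    and step: "\<And>i s. i < m \<Longrightarrow> I i s \<Longrightarrow>
      wp P c s (\<lambda>n s'. n \<le> t \<and> I (Suc i) (set_nat v 0 (Suc (nats s' v 0)) s'))"
  shows "wp P (for_loop v e c) s (\<lambda>n s'. n \<le> 2 + m * (t + 2) \<and> I m s')"
proof -
  have "wp P (While (NLess (nvar v) e) (Seq c (nset v (NAdd (nvar v) (NConst 1)))))
      (set_nat v 0 0 s) (\<lambda>n s'. n \<le> 1 + m * (Suc t + 1) \<and> I m s')"
  proof (rule wp_While)
    fix i s assume i: "i < m" "I i s"
    then show "bval P (NLess (nvar v) e) s \<and>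
      wp P (Seq c (nset v (NAdd (nvar v) (NConst 1)))) s (\<lambda>n s'. n \<le> Suc t \<and> I (Suc i) s')"
      using bound[OF i(2)] step[OF i] by (auto simp: wp_Seq elim: wp_mono)
  qed (use init bound in auto)
  then show ?thesis by (auto simp: for_loop_def wp_Seq elim: wp_mono)
qed

text \<open>The least natural number whose multiple of \<open>b\<close> is at least \<open>a\<close>. Counting is the only way to get
  from reals to naturals, and takes constant time if \<open>a\<close> and \<open>b\<close> only depend on the service.\<close>

definition round_up :: "string \<Rightarrow> rexp \<Rightarrow> rexp \<Rightarrow> com" where
  "round_up v a b =
     Seq (nset v (NConst 0))
       (While (RLess (RMul (OfNat (nvar v)) b) a) (nset v (NAdd (nvar v) (NConst 1))))"

lemma wp_round_up:
  assumes m: "a' \<le> real m * b'" "\<And>i. i < m \<Longrightarrow> real i * b' < a'"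
    and ab: "\<And>s'. unchanged {v} s s' \<Longrightarrow> rval P a s' = a' \<and> rval P b s' = b'"
  shows "wp P (round_up v a b) s (\<lambda>n s'. n \<le> 2 + 2 * m \<and> unchanged {v} s s' \<and> nats s' v 0 = m)"
proof -
  let ?I = "\<lambda>i s'. unchanged {v} s s' \<and> nats s' v 0 = i"
  have "wp P (While (RLess (RMul (OfNat (nvar v)) b) a) (nset v (NAdd (nvar v) (NConst 1))))
      (set_nat v 0 0 s) (\<lambda>n s'. n \<le> 1 + m * (1 + 1) \<and> ?I m s')"
    by (rule wp_While) (use m ab in \<open>auto simp: unchanged_def not_less\<close>)
  then show ?thesis by (auto simp: round_up_def wp_Seq elim: wp_mono)
qed

definition divide :: "string \<Rightarrow> string \<Rightarrow> nexp \<Rightarrow> string \<Rightarrow> com" where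
  "divide q r a b =
     Seq (nset r a) (Seq (nset q (NConst 0))
       (While (Not (NLess (nvar r) (nvar b)))
         (Seq (nset r (NSub (nvar r) (nvar b))) (nset q (NAdd (nvar q) (NConst 1))))))"

lemma wp_divide:
  assumes "distinct [q, r, b]" "0 < nats s b 0"
  shows "wp P (divide q r a b) s (\<lambda>n s'. n \<le> 3 + 3 * (nval a s div nats s b 0) \<and>
    unchanged {q, r} s s' \<and> nats s' q 0 = nval a s div nats s b 0 \<and> nats s' r 0 = nval a s mod nats s b 0)"
proof -
  let ?a = "nval a s" and ?b = "nats s b 0"
  let ?I = "\<lambda>i s'. unchanged {q, r} s s' \<and> nats s' q 0 = i \<and> nats s' r 0 = ?a - i * ?b"
  have "wp P (While (Not (NLess (nvar r) (nvar b)))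
      (Seq (nset r (NSub (nvar r) (nvar b))) (nset q (NAdd (nvar q) (NConst 1)))))
      (set_nat q 0 0 (set_nat r 0 ?a s)) (\<lambda>n s'. n \<le> 1 + (?a div ?b) * (2 + 1) \<and> ?I (?a div ?b) s')"
  proof (rule wp_While)
    fix i s' assume i: "i < ?a div ?b" and I: "?I i s'"
    have "(i + 1) * ?b \<le> (?a div ?b) * ?b" using i by (intro mult_right_mono) auto
    also have "\<dots> \<le> ?a" by simp
    finally have "?b \<le> ?a - i * ?b" by simp
    then show "bval P (Not (NLess (nvar r) (nvar b))) s' \<and>
      wp P (Seq (nset r (NSub (nvar r) (nvar b))) (nset q (NAdd (nvar q) (NConst 1)))) s'
        (\<lambda>n s'. n \<le> 2 \<and> ?I (Suc i) s')"
      using I assms by (auto simp: unchanged_def wp_Seq)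
  next
    fix s' assume "?I (?a div ?b) s'"
    then show "\<not> bval P (Not (NLess (nvar r) (nvar b))) s'"
      using assms by (auto simp: unchanged_def minus_div_mult_eq_mod)
  qed (use assms in \<open>auto simp: unchanged_def\<close>)
  then show ?thesis
    using assms by (auto simp: divide_def wp_Seq minus_div_mult_eq_mod elim!: wp_mono)
qed

lemma wp_divideI:
  assumes "distinct [q, r, b]" "0 < nats s b 0"
    and "\<And>n s'. n \<le> 3 + 3 * (nval a s div nats s b 0) \<Longrightarrow> unchanged {q, r} s s' \<Longrightarrow>
      nats s' q 0 = nval a s div nats s b 0 \<Longrightarrow> nats s' r 0 = nval a s mod nats s b 0 \<Longrightarrow> Q n s'"
  shows "wp P (divide q r a b) s Q"
  using wp_divide[OF assms(1,2)] by (rule wp_mono) (use assms(3) in auto)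

section \<open>The program\<close>

definition total_exp :: rexp where "total_exp = Query Demand Period"
definition cargo_exp :: rexp where "cargo_exp = RMul Loading Capacity"

definition last_departure_exp :: rexp where
  "last_departure_exp =
     RAdd (RAdd Period
       (RAdd (RAdd Period cargo_exp) (RMul (OfNat (nvar ''loads'')) (RAdd ReturnTime cargo_exp))))
       ReturnTime"

definition last_instant_exp :: rexp where
  "last_instant_exp =
     RAdd (RAdd (RAdd (RAdd last_departure_exp Period) cargo_exp) (RMul (OfNat (NConst 2)) ReturnTime))
       (RMul (OfNat (nvar ''rounds'')) (RAdd (RMul (OfNat (NConst 2)) ReturnTime) cargo_exp))"

definition big_exp :: rexp where "big_exp = RMul (OfNat (nvar ''ticks'')) ReturnTime"

definition instant_exp :: "nexp \<Rightarrow> rexp" where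
  "instant_exp e = RSub (RMul (OfNat e) (RDiv ReturnTime (OfNat (nvar ''M'')))) ReturnTime"

definition set_level :: "string \<Rightarrow> nexp \<Rightarrow> com" where
  "set_level x e =
     Seq (rset x (RMul (OfNat e) (RDiv Capacity (OfNat (nvar ''M'')))))
       (If (RLess total_exp (rvar x)) (rset x total_exp) Skip)"

text \<open>In all program fragments, \<open>w\<close> and \<open>k\<close> are window and level of the state \<open>c\<close>; \<open>l\<close>,
  \<open>oldest\<close> and \<open>rest\<close> are the most recent instant, the oldest one, and the window without the latter;
  \<open>l1\<close> and \<open>k1\<close> are instant and level of the action \<open>a\<close>. The layer with \<open>n\<close> remaining departures
  occupies \<open>V\<close> from address \<open>o = n * codes\<close> on.\<close>

definition successor_exp :: nexp where
  "successor_exp =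
     NAdd (NMul (NAdd (NMul (nvar ''rest'') (nvar ''instants'')) (nvar ''l1'')) (nvar ''levels'')) (nvar ''k1'')"

definition prepare :: com where
  "prepare =
     Seq (round_up ''loads'' total_exp Capacity)
    (Seq (round_up ''rounds'' last_departure_exp ReturnTime)
    (Seq (round_up ''ticks'' last_instant_exp ReturnTime)
    (Seq (nset ''levels'' (NAdd (NMul (nvar ''M'') (nvar ''loads'')) (NConst 1)))
    (Seq (nset ''instants'' (NMul (nvar ''M'') (nvar ''ticks'')))
    (Seq (nset ''horizon'' (NMul (nvar ''S'') (nvar ''rounds'')))
    (Seq (nset ''tail'' (NConst 1))
    (Seq (for_loop ''i'' (NSub (nvar ''S'') (NConst 1))
           (nset ''tail'' (NMul (nvar ''tail'') (nvar ''instants''))))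
    (Seq (nset ''actions'' (NMul (nvar ''instants'') (nvar ''levels'')))
         (nset ''codes'' (NMul (NMul (nvar ''tail'') (nvar ''instants'')) (nvar ''levels'')))))))))))"

definition decode :: com where
  "decode =
     Seq (divide ''w'' ''k'' (nvar ''c'') ''levels'')
    (Seq (divide ''u'' ''l'' (nvar ''w'') ''instants'')
    (Seq (divide ''oldest'' ''rest'' (nvar ''w'') ''tail'')
         (set_level ''yk'' (nvar ''k''))))"

definition allowed_exp :: bexp where
  "allowed_exp =
     And (Not (RLess (rvar ''x'') (OfNat (NConst 0))))
    (And (Not (RLess Capacity (rvar ''x'')))
    (And (Not (NLess (nvar ''l1'') (nvar ''l'')))
    (And (Not (RLess (rvar ''t'') (RAdd (Query Taubar (rvar ''y1'')) (RMul Loading (rvar ''x'')))))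
         (Not (RLess (rvar ''t'')
           (RAdd (RAdd (instant_exp (nvar ''oldest'')) ReturnTime) (RMul Loading (rvar ''x''))))))))"

definition examine :: com where
  "examine =
     Seq (divide ''l1'' ''k1'' (nvar ''a'') ''levels'')
    (Seq (set_level ''y1'' (nvar ''k1''))
    (Seq (rset ''x'' (RSub (rvar ''y1'') (rvar ''yk'')))
    (Seq (rset ''t'' (instant_exp (nvar ''l1'')))
         (If allowed_exp
           (Seq (rset ''v'' (RGet ''V'' (NAdd (nvar ''o'') successor_exp)))
           (Seq (rset ''e'' (RSub (rvar ''t'') (Query Tau (rvar ''yk''))))
           (Seq (If (And (RLess (rvar ''yk'') (rvar ''y1'')) (RLess (rvar ''v'') (rvar ''e'')))
                   (rset ''v'' (rvar ''e'')) Skip)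
                (If (RLess (rvar ''v'') (rvar ''best''))
                   (Seq (rset ''best'' (rvar ''v'')) (nset ''act'' (nvar ''a''))) Skip))))
           Skip))))"

definition search :: com where
  "search =
     Seq decode
    (Seq (rset ''best'' big_exp)
    (Seq (nset ''act'' (NConst 0))
         (for_loop ''a'' (nvar ''actions'') examine)))"

definition last_layer :: com where
  "last_layer =
     for_loop ''c'' (nvar ''codes'')
       (Seq (divide ''w'' ''k'' (nvar ''c'') ''levels'')
       (Seq (set_level ''yk'' (nvar ''k''))
            (If (RLess (rvar ''yk'') total_exp)
              (RSet ''V'' (nvar ''c'') big_exp)
              (RSet ''V'' (nvar ''c'') (OfNat (NConst 0))))))"

definition all_layers :: com where
  "all_layers =
     Seq (nset ''o'' (NConst 0))
       (for_loop ''j'' (nvar ''horizon'')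
         (Seq (for_loop ''c'' (nvar ''codes'')
                (Seq search
                  (RSet ''V'' (NAdd (NAdd (nvar ''o'') (nvar ''codes'')) (nvar ''c'')) (rvar ''best''))))
              (nset ''o'' (NAdd (nvar ''o'') (nvar ''codes'')))))"

text \<open>The minimising actions are searched for a second time instead of being stored for each state.\<close>

definition read_plan :: com where
  "read_plan =
     Seq (nset ''c'' (NConst 0))
       (for_loop ''j'' (nvar ''horizon'')
         (Seq (nset ''o'' (NSub (nvar ''o'') (nvar ''codes'')))
         (Seq search
         (Seq (divide ''l1'' ''k1'' (nvar ''act'') ''levels'')
         (Seq (set_level ''y1'' (nvar ''k1''))
         (Seq (RSet ''d'' (NAdd (nvar ''j'') (NConst 1)) (instant_exp (nvar ''l1'')))
         (Seq (RSet ''y'' (NAdd (nvar ''j'') (NConst 1)) (rvar ''y1''))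
              (nset ''c'' successor_exp))))))))"

definition program :: com where
  "program =
     Seq prepare (Seq last_layer (Seq all_layers (Seq read_plan (nset ''n'' (nvar ''horizon'')))))"

section \<open>Correctness and cost of the program\<close>

context shuttle_grid
begin

text \<open>Each table access of the program thus stays within one layer.\<close>

lemma successor_less: "a < actions \<Longrightarrow> successor c a < codes"
proof -
  assume a: "a < actions"
  note d = action_digits[OF a]
  let ?w = "(c div levels) mod tail_weight * instants + a div levels"
  have "(c div levels) mod tail_weight < tail_weight" by (rule mod_less_divisor) simp
  then have "Suc ((c div levels) mod tail_weight) * instants \<le> tail_weight * instants"
    by (intro mult_right_mono Suc_leI) auto
  then have "Suc ?w \<le> tail_weight * instants" using d by simp
  then have "Suc ?w * levels \<le> tail_weight * instants * levels" by (intro mult_right_mono) auto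
  then have "?w * levels + levels \<le> codes" by (simp add: codes_def)
  then show ?thesis unfolding successor_def using d(2) by linarith
qed

lemma total_exp_val: "rval P total_exp s = total_demand P"
  using valid_serviceD(2)[OF valid] by (simp add: total_exp_def total_demand_def)

lemma query_level:
  "query_val P Tau (level k) = tau P (level k)"
  "query_val P Taubar (level k) = taubar P (level k)"
  using level_bounds[of k] by auto

text \<open>The parameters have been computed. No later program part writes to them.\<close>

definition prepared :: "state \<Rightarrow> bool" where
  "prepared s \<longleftrightarrow>
     nats s ''M'' 0 = M \<and> nats s ''ticks'' 0 = ticks \<and> nats s ''levels'' 0 = levels \<and>
     nats s ''instants'' 0 = instants \<and> nats s ''horizon'' 0 = horizon \<and>
     nats s ''tail'' 0 = tail_weight \<and> nats s ''actions'' 0 = actions \<and> nats s ''codes'' 0 = codes"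

lemma preparedD:
  assumes "prepared s"
  shows "nats s ''M'' 0 = M" "nats s ''levels'' 0 = levels"
    "nats s ''instants'' 0 = instants" "nats s ''horizon'' 0 = horizon"
    "nats s ''tail'' 0 = tail_weight" "nats s ''actions'' 0 = actions" "nats s ''codes'' 0 = codes"
    "rval P (instant_exp e) s = instant (nval e s)" "rval P big_exp s = big"
  using assms by (auto simp: prepared_def instant_exp_def big_exp_def instant_def big_def)

lemma prepared_unchanged:
  assumes "prepared s" "unchanged X s s'"
    and "X \<inter> {''M'', ''ticks'', ''levels'', ''instants'', ''horizon'', ''tail'', ''actions'', ''codes''} = {}"
      (is "_ \<inter> ?params = {}")
  shows "prepared s'"
proof -
  have "nats s' a = nats s a" if "a \<in> ?params" for a
  proof (rule unchangedD(1)[OF assms(2)], rule)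
    assume "a \<in> X"
    from disjoint_iff[THEN iffD1, OF assms(3), rule_format, OF this] show False
      using that by (rule notE)
  qed
  then show ?thesis using assms(1) by (simp add: prepared_def)
qed

lemma wp_set_levelI:
  assumes "nats s ''M'' 0 = M"
    and "\<And>n s'. n \<le> 3 \<Longrightarrow> unchanged {x} s s' \<Longrightarrow> nats s' = nats s \<Longrightarrow>
      reals s' x 0 = level (nval e s) \<Longrightarrow> Q n s'"
  shows "wp P (set_level x e) s Q"
  by (simp add: set_level_def wp_Seq wp_If total_exp_val assms(1) level_def)
    (auto intro!: assms(2) simp: level_def min_def unchanged_def)

text \<open>The parts of the state \<open>c\<close> that the scan of the actions uses.\<close>

definition decoded :: "nat \<Rightarrow> state \<Rightarrow> bool" where
  "decoded c s \<longleftrightarrow>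
     nats s ''l'' 0 = c div levels mod instants \<and>
     nats s ''oldest'' 0 = c div levels div tail_weight \<and>
     nats s ''rest'' 0 = c div levels mod tail_weight \<and>
     reals s ''yk'' 0 = level (c mod levels)"

lemma wp_decode:
  assumes p: "prepared s" and c: "nats s ''c'' 0 = c" "c < codes"
  shows "wp P decode s (\<lambda>n s'. n \<le> 12 + 9 * codes \<and>
    unchanged {''w'', ''k'', ''u'', ''l'', ''oldest'', ''rest'', ''yk''} s s' \<and> decoded c s')"
  unfolding decode_def wp_Seq
proof (rule wp_divideI)
  fix n1 :: nat and s1
  assume n1: "n1 \<le> 3 + 3 * (nval (nvar ''c'') s div nats s ''levels'' 0)"
    and u1: "unchanged {''w'', ''k''} s s1"
    and w: "nats s1 ''w'' 0 = nval (nvar ''c'') s div nats s ''levels'' 0"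
    and k: "nats s1 ''k'' 0 = nval (nvar ''c'') s mod nats s ''levels'' 0"
  have p1: "prepared s1" using prepared_unchanged[OF p u1] by simp
  note v1 = n1 w k
  note v1 = v1[simplified, unfolded preparedD[OF p] c]
  show "wp P (divide ''u'' ''l'' (nvar ''w'') ''instants'') s1
    (\<lambda>m s''. wp P (divide ''oldest'' ''rest'' (nvar ''w'') ''tail'') s''
      (\<lambda>n' s'''. wp P (set_level ''yk'' (nvar ''k'')) s'''
        (\<lambda>m' s'. n1 + (m + (n' + m')) \<le> 12 + 9 * codes \<and>
          unchanged {''w'', ''k'', ''u'', ''l'', ''oldest'', ''rest'', ''yk''} s s' \<and> decoded c s')))"
  proof (rule wp_divideI)
    fix n2 :: nat and s2
    assume n2: "n2 \<le> 3 + 3 * (nval (nvar ''w'') s1 div nats s1 ''instants'' 0)"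
      and u2: "unchanged {''u'', ''l''} s1 s2"
      and l: "nats s2 ''l'' 0 = nval (nvar ''w'') s1 mod nats s1 ''instants'' 0"
    have p2: "prepared s2" using prepared_unchanged[OF p1 u2] by simp
    note v2 = n2 l
    note v2 = v2[simplified, unfolded preparedD[OF p1] v1(2,3)]
    show "wp P (divide ''oldest'' ''rest'' (nvar ''w'') ''tail'') s2
      (\<lambda>n' s'''. wp P (set_level ''yk'' (nvar ''k'')) s'''
        (\<lambda>m' s'. n1 + (n2 + (n' + m')) \<le> 12 + 9 * codes \<and>
          unchanged {''w'', ''k'', ''u'', ''l'', ''oldest'', ''rest'', ''yk''} s s' \<and> decoded c s'))"
    proof (rule wp_divideI)
      fix n3 :: nat and s3
      assume n3: "n3 \<le> 3 + 3 * (nval (nvar ''w'') s2 div nats s2 ''tail'' 0)"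
        and u3: "unchanged {''oldest'', ''rest''} s2 s3"
        and o: "nats s3 ''oldest'' 0 = nval (nvar ''w'') s2 div nats s2 ''tail'' 0"
        and r: "nats s3 ''rest'' 0 = nval (nvar ''w'') s2 mod nats s2 ''tail'' 0"
      have p3: "prepared s3" using prepared_unchanged[OF p2 u3] by simp
      have w2: "nats s2 ''w'' 0 = c div levels" using unchangedD(1)[OF u2] v1 by simp
      note v3 = n3 o r
      note v3 = v3[simplified, unfolded preparedD[OF p2] w2]
      show "wp P (set_level ''yk'' (nvar ''k'')) s3
        (\<lambda>m' s'. n1 + (n2 + (n3 + m')) \<le> 12 + 9 * codes \<and>
          unchanged {''w'', ''k'', ''u'', ''l'', ''oldest'', ''rest'', ''yk''} s s' \<and> decoded c s')"
      proof (rule wp_set_levelI)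
        fix n4 :: nat and s4
        assume n4: "n4 \<le> 3" and u4: "unchanged {''yk''} s3 s4"
          and y: "reals s4 ''yk'' 0 = level (nval (nvar ''k'') s3)"
        have "c div levels \<le> codes" "c div levels div instants \<le> codes" "c div levels div tail_weight \<le> codes"
          using c(2) by (meson div_le_dividend le_trans less_imp_le)+
        moreover have "nats s3 ''k'' 0 = c mod levels"
          using unchangedD(1)[OF u3] unchangedD(1)[OF u2] v1 by simp
        moreover have "nats s4 ''l'' 0 = c div levels mod instants"
          using unchangedD(1)[OF u4] unchangedD(1)[OF u3] v2 by simp
        moreover have "unchanged {''w'', ''k'', ''u'', ''l'', ''oldest'', ''rest'', ''yk''} s s4"
          using u1 u2 u3 u4 by (auto simp: unchanged_def)
        ultimately show "n1 + (n2 + (n3 + n4)) \<le> 12 + 9 * codes \<and>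
          unchanged {''w'', ''k'', ''u'', ''l'', ''oldest'', ''rest'', ''yk''} s s4 \<and> decoded c s4"
          using n4 y v1 v2 v3 unchangedD(1)[OF u4] by (simp add: decoded_def)
      qed (use preparedD[OF p3] in simp)
    qed (use preparedD[OF p2] in simp_all)
  qed (use preparedD[OF p1] in simp_all)
qed (use preparedD[OF p] in simp_all)

text \<open>One iteration of the scan performs one step of the recursion \<open>best\<close>.\<close>

lemma wp_examine:
  assumes p: "prepared s" and c: "decoded c s" and a: "nats s ''a'' 0 = a" "a < actions"
    and V: "\<And>f. f < codes \<Longrightarrow> reals s ''V'' (nats s ''o'' 0 + f) = F f"
    and best: "reals s ''best'' 0 = fst (best F c a)" "nats s ''act'' 0 = snd (best F c a)"
  shows "wp P examine s (\<lambda>n s'. n \<le> 3 * instants + 20 \<and>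
    unchanged {''l1'', ''k1'', ''y1'', ''x'', ''t'', ''v'', ''e'', ''best'', ''act''} s s' \<and>
    reals s' ''best'' 0 = fst (best F c (Suc a)) \<and> nats s' ''act'' 0 = snd (best F c (Suc a)))"
    (is "wp P examine s ?Q")
proof -
  let ?rest = "Seq (rset ''x'' (RSub (rvar ''y1'') (rvar ''yk'')))
    (Seq (rset ''t'' (instant_exp (nvar ''l1'')))
         (If allowed_exp
           (Seq (rset ''v'' (RGet ''V'' (NAdd (nvar ''o'') successor_exp)))
           (Seq (rset ''e'' (RSub (rvar ''t'') (Query Tau (rvar ''yk''))))
           (Seq (If (And (RLess (rvar ''yk'') (rvar ''y1'')) (RLess (rvar ''v'') (rvar ''e'')))
                   (rset ''v'' (rvar ''e'')) Skip)
                (If (RLess (rvar ''v'') (rvar ''best''))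
                   (Seq (rset ''best'' (rvar ''v'')) (nset ''act'' (nvar ''a''))) Skip))))
           Skip))"
  let ?k = "c mod levels" and ?k' = "a mod levels" and ?l' = "a div levels"
  have main: "wp P ?rest s2 (\<lambda>n. ?Q (m + n))"
    if m: "m \<le> 3 * instants + 6" and u: "unchanged {''l1'', ''k1'', ''y1''} s s2"
      and l1: "nats s2 ''l1'' 0 = ?l'" and k1: "nats s2 ''k1'' 0 = ?k'"
      and y1: "reals s2 ''y1'' 0 = level ?k'" for m s2
  proof -
    have p2: "prepared s2" using prepared_unchanged[OF p u] by simp
    note pd = preparedD[OF p2]
    have s2: "nats s2 ''a'' 0 = a" "nats s2 ''l'' 0 = c div levels mod instants"
      "nats s2 ''oldest'' 0 = c div levels div tail_weight"
      "nats s2 ''rest'' 0 = c div levels mod tail_weight"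
      "reals s2 ''yk'' 0 = level ?k"
      "reals s2 ''best'' 0 = fst (best F c a)" "nats s2 ''act'' 0 = snd (best F c a)"
      "nats s2 ''o'' = nats s ''o''" "reals s2 ''V'' = reals s ''V''"
      using unchangedD[OF u] a c best by (simp_all add: decoded_def)
    define s3 where "s3 = set_real ''x'' 0 (level ?k' - level ?k) s2"
    define s4 where "s4 = set_real ''t'' 0 (instant ?l') s3"
    have p4: "prepared s4" using p2 by (simp add: prepared_def s4_def s3_def)
    have p3: "prepared s3" using p2 by (simp add: prepared_def s3_def)
    have s4: "nats s4 = nats s2" "reals s4 ''t'' 0 = instant ?l'" "reals s4 ''x'' 0 = level ?k' - level ?k"
      "reals s4 ''y1'' 0 = level ?k'" "reals s4 ''yk'' 0 = level ?k"
      "reals s4 ''best'' 0 = fst (best F c a)" "reals s4 ''V'' = reals s ''V''"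
      by (simp_all add: s4_def s3_def s2 y1)
    have al: "bval P allowed_exp s4 = allowed c a"
      by (simp add: allowed_exp_def allowed_def Let_def s4 s2 l1 preparedD(8)[OF p4] query_level
        del: query_val.simps)
    have suc: "nval successor_exp s4 = successor c a"
      by (simp add: successor_exp_def successor_def s4 s2 l1 k1 pd)
    have v: "reals s ''V'' (nats s ''o'' 0 + successor c a) = F (successor c a)"
      using V successor_less[OF a(2)] by blast
    have u4: "unchanged {''l1'', ''k1'', ''y1'', ''x'', ''t'', ''v'', ''e'', ''best'', ''act''} s s4"
      unfolding s4_def s3_def using u by (auto simp: unchanged_def)
    have start: "wp P ?rest s2 R = wp P (If allowed_exp
           (Seq (rset ''v'' (RGet ''V'' (NAdd (nvar ''o'') successor_exp)))
           (Seq (rset ''e'' (RSub (rvar ''t'') (Query Tau (rvar ''yk''))))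
           (Seq (If (And (RLess (rvar ''yk'') (rvar ''y1'')) (RLess (rvar ''v'') (rvar ''e'')))
                   (rset ''v'' (rvar ''e'')) Skip)
                (If (RLess (rvar ''v'') (rvar ''best''))
                   (Seq (rset ''best'' (rvar ''v'')) (nset ''act'' (nvar ''a''))) Skip))))
           Skip) s4 (\<lambda>n. R (Suc (Suc n)))" for R
      by (simp add: wp_Seq s2 y1 s3_def[symmetric] preparedD(8)[OF p3] s4_def)
        (simp add: s3_def l1)
    show ?thesis
    proof (cases "allowed c a")
      case False
      then show ?thesis unfolding start wp_If al using m u4 s2 s4 by simp
    next
      case True
      have "through F c a = (if level ?k < level ?k' \<and> F (successor c a) < instant ?l' - tau P (level ?k)
          then instant ?l' - tau P (level ?k) else F (successor c a))"
        by (simp add: through_def Let_def)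
      then show ?thesis
        unfolding start wp_If al using m u4 s2 s4 True v
        by (simp add: wp_Seq wp_If suc query_level del: query_val.simps)
          (auto intro!: unchanged_set)
    qed
  qed
  show ?thesis
    unfolding examine_def wp_Seq[of _ "divide _ _ _ _"]
  proof (rule wp_divideI)
    fix n1 :: nat and s1
    assume n1: "n1 \<le> 3 + 3 * (nval (nvar ''a'') s div nats s ''levels'' 0)"
      and u1: "unchanged {''l1'', ''k1''} s s1"
      and l1: "nats s1 ''l1'' 0 = nval (nvar ''a'') s div nats s ''levels'' 0"
      and k1: "nats s1 ''k1'' 0 = nval (nvar ''a'') s mod nats s ''levels'' 0"
    have p1: "prepared s1" using prepared_unchanged[OF p u1] by simp
    note v1 = n1 l1 k1
    note v1 = v1[simplified, unfolded preparedD[OF p] a]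
    show "wp P (Seq (set_level ''y1'' (nvar ''k1'')) ?rest) s1 (\<lambda>n. ?Q (n1 + n))"
      unfolding wp_Seq[of _ "set_level _ _"]
    proof (rule wp_set_levelI)
      fix n2 :: nat and s2
      assume n2: "n2 \<le> 3" "unchanged {''y1''} s1 s2" "nats s2 = nats s1"
        "reals s2 ''y1'' 0 = level (nval (nvar ''k1'') s1)"
      have "unchanged {''l1'', ''k1'', ''y1''} s s2"
        using u1 n2(2) by (rule unchanged_trans) auto
      moreover have "n1 + n2 \<le> 3 * instants + 6" using action_digits(1)[OF a(2)] v1(1) n2(1) by simp
      ultimately have "wp P ?rest s2 (\<lambda>n. ?Q (n1 + n2 + n))"
        using n2(3,4) v1 by (intro main) simp_all
      then show "wp P ?rest s2 (\<lambda>n. ?Q (n1 + (n2 + n)))" by (simp only: add.assoc)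
    qed (use preparedD[OF p1] in simp)
  qed (use preparedD[OF p] in simp_all)
qed

text \<open>All variables that a search modifies.\<close>

abbreviation scratch :: "string set" where
  "scratch \<equiv> {''w'', ''k'', ''u'', ''l'', ''oldest'', ''rest'', ''yk'',
     ''l1'', ''k1'', ''y1'', ''x'', ''t'', ''v'', ''e'', ''best'', ''act'', ''a''}"

definition search_time :: nat where
  "search_time = 16 + 9 * codes + actions * (3 * instants + 22)"

lemma wp_search:
  assumes p: "prepared s" and c: "nats s ''c'' 0 = c" "c < codes"
    and V: "\<And>f. f < codes \<Longrightarrow> reals s ''V'' (nats s ''o'' 0 + f) = F f"
  shows "wp P search s (\<lambda>n s'. n \<le> search_time \<and> unchanged scratch s s' \<and>
    nats s' ''rest'' 0 = c div levels mod tail_weight \<and>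
    reals s' ''best'' 0 = fst (best F c actions) \<and> nats s' ''act'' 0 = snd (best F c actions))"
    (is "wp P search s ?Q")
  unfolding search_def wp_Seq[of _ decode]
proof (rule wp_mono[OF wp_decode[OF p c]], elim conjE)
  fix n1 :: nat and s1
  assume n1: "n1 \<le> 12 + 9 * codes" and d1: "decoded c s1"
    and u1: "unchanged {''w'', ''k'', ''u'', ''l'', ''oldest'', ''rest'', ''yk''} s s1"
  have p1: "prepared s1" using prepared_unchanged[OF p u1] by simp
  let ?s2 = "set_nat ''act'' 0 0 (set_real ''best'' 0 big s1)"
  let ?I = "\<lambda>i s'. unchanged scratch s s' \<and> decoded c s' \<and> nats s' ''a'' 0 = i \<and>
    reals s' ''best'' 0 = fst (best F c i) \<and> nats s' ''act'' 0 = snd (best F c i)"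
  have prep: "prepared s'" if "unchanged scratch s s'" for s'
    using prepared_unchanged[OF p that] by simp
  have "wp P (for_loop ''a'' (nvar ''actions'') examine) ?s2
    (\<lambda>n s'. n \<le> 2 + actions * (3 * instants + 20 + 2) \<and> ?I actions s')"
  proof (rule wp_for_loop[where I = ?I and m = actions])
    show "?I 0 (set_nat ''a'' 0 0 ?s2)"
      using u1 d1 by (simp add: decoded_def) (auto simp: unchanged_def)
    fix i s' assume I: "?I i s'"
    then have p': "prepared s'" using prep by blast
    then show "nats s' ''a'' 0 = i \<and> nval (nvar ''actions'') s' = actions"
      using I preparedD(6) by simp
    assume i: "i < actions"
    have u': "unchanged scratch s s'" and d': "decoded c s'" and a': "nats s' ''a'' 0 = i"
      and best': "reals s' ''best'' 0 = fst (best F c i)" "nats s' ''act'' 0 = snd (best F c i)"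
      using I by blast+
    have V': "reals s' ''V'' (nats s' ''o'' 0 + f) = F f" if "f < codes" for f
      using V[OF that] unchangedD[OF u'] by simp
    show "wp P examine s' (\<lambda>n s''. n \<le> 3 * instants + 20 \<and>
      ?I (Suc i) (set_nat ''a'' 0 (Suc (nats s'' ''a'' 0)) s''))"
    proof (rule wp_mono[OF wp_examine[OF p' d' a' i V' best']], assumption, elim conjE)
      fix n s''
      assume *: "n \<le> 3 * instants + 20"
        "unchanged {''l1'', ''k1'', ''y1'', ''x'', ''t'', ''v'', ''e'', ''best'', ''act''} s' s''"
        "reals s'' ''best'' 0 = fst (best F c (Suc i))" "nats s'' ''act'' 0 = snd (best F c (Suc i))"
      have "unchanged scratch s s''" using u' *(2) by (rule unchanged_trans) auto
      then have "unchanged scratch s (set_nat ''a'' 0 (Suc (nats s'' ''a'' 0)) s'')" by (rule unchanged_set) simp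
      then show "n \<le> 3 * instants + 20 \<and> ?I (Suc i) (set_nat ''a'' 0 (Suc (nats s'' ''a'' 0)) s'')"
        using * d' I unchangedD[OF *(2)] by (simp add: decoded_def del: best.simps)
    qed
  qed
  then show "wp P (Seq (rset ''best'' big_exp) (Seq (nset ''act'' (NConst 0))
    (for_loop ''a'' (nvar ''actions'') examine))) s1 (\<lambda>n. ?Q (n1 + n))"
    unfolding wp_Seq wp_basic rval.simps nval.simps preparedD(9)[OF p1]
    by (rule wp_mono) (use n1 in \<open>auto simp: search_time_def decoded_def algebra_simps\<close>)
qed

lemma wp_last_layer:
  assumes p: "prepared s"
  shows "wp P last_layer s (\<lambda>n s'. n \<le> 2 + codes * (3 * codes + 10) \<and>
    unchanged (scratch \<union> {''c'', ''V''}) s s' \<and> (\<forall>f<codes. reals s' ''V'' f = wait 0 f))"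
proof -
  let ?X = "scratch \<union> {''c'', ''V''}"
  let ?I = "\<lambda>i s'. unchanged ?X s s' \<and> nats s' ''c'' 0 = i \<and> (\<forall>f<i. reals s' ''V'' f = wait 0 f)"
  have prep: "prepared s'" if "unchanged ?X s s'" for s'
    using prepared_unchanged[OF p that] by simp
  have "wp P last_layer s (\<lambda>n s'. n \<le> 2 + codes * ((3 * codes + 8) + 2) \<and> ?I codes s')"
    unfolding last_layer_def
  proof (rule wp_for_loop[where I = ?I and m = codes])
    show "?I 0 (set_nat ''c'' 0 0 s)" by (simp add: unchanged_set)
    fix i s' assume I: "?I i s'"
    then have p': "prepared s'" and u': "unchanged ?X s s'" using prep by blast+
    then show "nats s' ''c'' 0 = i \<and> nval (nvar ''codes'') s' = codes"
      using I preparedD(7) by simp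
    assume i: "i < codes"
    show "wp P (Seq (divide ''w'' ''k'' (nvar ''c'') ''levels'')
       (Seq (set_level ''yk'' (nvar ''k''))
            (If (RLess (rvar ''yk'') total_exp)
              (RSet ''V'' (nvar ''c'') big_exp)
              (RSet ''V'' (nvar ''c'') (OfNat (NConst 0)))))) s'
      (\<lambda>n s''. n \<le> 3 * codes + 8 \<and> ?I (Suc i) (set_nat ''c'' 0 (Suc (nats s'' ''c'' 0)) s''))"
      unfolding wp_Seq
    proof (rule wp_divideI, goal_cases)
      case (3 n1 s1)
      have p1: "prepared s1" using prepared_unchanged[OF p' 3(2)] by simp
      show ?case
      proof (rule wp_set_levelI, goal_cases)
        case (2 n2 s2)
        have p2: "prepared s2" using prepared_unchanged[OF p1 2(2)] by simp
        have u2: "unchanged ?X s s2"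
          using unchanged_trans[OF unchanged_trans[OF u' 3(2)] 2(2), of ?X ?X] by simp
        have "i div levels \<le> codes" using i by (meson div_le_dividend le_trans less_imp_le)
        then have n: "n1 + n2 + 2 \<le> 3 * codes + 8"
          using 3(1) 2(1) I preparedD(2)[OF p'] by simp
        have c2: "nats s2 ''c'' 0 = i" using unchangedD[OF 2(2)] unchangedD[OF 3(2)] I by simp
        have y2: "reals s2 ''yk'' 0 = level (i mod levels)"
          using 2(4) 3(4) I preparedD(2)[OF p'] by simp
        have V2: "reals s2 ''V'' = reals s' ''V''" using unchangedD[OF 2(2)] unchangedD[OF 3(2)] by simp
        show ?case
          using n c2 y2 V2 u2 I preparedD(9)[OF p2]
          by (auto simp: wp_If total_exp_val less_Suc_eq intro!: unchanged_set)
      qed (use preparedD[OF p1] in simp)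
    qed (use preparedD[OF p'] in simp_all)
  qed
  then show ?thesis by (rule wp_mono) (auto simp: algebra_simps)
qed

definition layer_time :: nat where
  "layer_time = codes * (search_time + 3) + 3"

text \<open>Layers occupy disjoint segments of the table, so writing a new one preserves the others.\<close>

lemma layer_index_less:
  "n \<le> i \<Longrightarrow> f < codes \<Longrightarrow> n * codes + f < i * codes + codes"
  by (metis add.commute add_less_le_mono mult_le_mono1)

lemma wp_all_layers:
  assumes p: "prepared s" and V: "\<forall>f<codes. reals s ''V'' f = wait 0 f"
  shows "wp P all_layers s (\<lambda>n s'. n \<le> 3 + horizon * (layer_time + 2) \<and>
    unchanged (scratch \<union> {''c'', ''V'', ''j'', ''o''}) s s' \<and> nats s' ''o'' 0 = horizon * codes \<and>
    (\<forall>n\<le>horizon. \<forall>f<codes. reals s' ''V'' (n * codes + f) = wait n f))"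
proof -
  let ?X = "scratch \<union> {''c'', ''V''}" and ?Y = "scratch \<union> {''c'', ''V'', ''j'', ''o''}"
  let ?table = "\<lambda>i s'. \<forall>n\<le>i. \<forall>f<codes. reals s' ''V'' (n * codes + f) = wait n f"
  let ?I = "\<lambda>i s'. unchanged ?Y s s' \<and> nats s' ''j'' 0 = i \<and> nats s' ''o'' 0 = i * codes \<and> ?table i s'"
  have prep: "prepared s'" if "unchanged ?Y s s'" for s'
    using prepared_unchanged[OF p that] by simp
  let ?inner = "for_loop ''c'' (nvar ''codes'')
    (Seq search (RSet ''V'' (NAdd (NAdd (nvar ''o'') (nvar ''codes'')) (nvar ''c'')) (rvar ''best'')))"
  have "wp P (for_loop ''j'' (nvar ''horizon'')
         (Seq ?inner (nset ''o'' (NAdd (nvar ''o'') (nvar ''codes''))))) (set_nat ''o'' 0 0 s)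
    (\<lambda>n s'. n \<le> 2 + horizon * (layer_time + 2) \<and> ?I horizon s')"
  proof (rule wp_for_loop[where I = ?I and m = horizon])
    show "?I 0 (set_nat ''j'' 0 0 (set_nat ''o'' 0 0 s))" using V by (simp add: unchanged_set)
    fix i s1 assume I: "?I i s1"
    then have p1: "prepared s1" and u1: "unchanged ?Y s s1" using prep by blast+
    then show "nats s1 ''j'' 0 = i \<and> nval (nvar ''horizon'') s1 = horizon"
      using I preparedD(4) by simp
    \<comment> \<open>The layer for \<open>Suc i\<close> remaining departures is filled from left to right.\<close>
    let ?J = "\<lambda>c s'. unchanged ?X s1 s' \<and> nats s' ''c'' 0 = c \<and> ?table i s' \<and>
      (\<forall>f<c. reals s' ''V'' (i * codes + codes + f) = wait (Suc i) f)"
    have "wp P ?inner s1 (\<lambda>n s'. n \<le> 2 + codes * ((search_time + 1) + 2) \<and> ?J codes s')"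
    proof (rule wp_for_loop[where I = ?J and m = codes])
      show "?J 0 (set_nat ''c'' 0 0 s1)" using I by (simp add: unchanged_set)
      fix c s' assume J: "?J c s'"
      then have u': "unchanged ?X s1 s'" by blast
      then have p': "prepared s'" using prepared_unchanged[OF p1 u'] by simp
      then show "nats s' ''c'' 0 = c \<and> nval (nvar ''codes'') s' = codes"
        using J preparedD(7) by simp
      assume c: "c < codes"
      have o': "nats s' ''o'' 0 = i * codes" using I unchangedD[OF u'] by simp
      have V': "reals s' ''V'' (nats s' ''o'' 0 + f) = wait i f" if "f < codes" for f
        using J that o' by simp
      show "wp P (Seq search (RSet ''V'' (NAdd (NAdd (nvar ''o'') (nvar ''codes'')) (nvar ''c'')) (rvar ''best'')))
        s' (\<lambda>n s''. n \<le> search_time + 1 \<and> ?J (Suc c) (set_nat ''c'' 0 (Suc (nats s'' ''c'' 0)) s''))"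
        unfolding wp_Seq
      proof (rule wp_mono[OF wp_search[OF p' _ c V']], goal_cases)
        case (2 f)
        then show ?case .
      next
        case (3 n s'')
        then have n: "n \<le> search_time" and u: "unchanged scratch s' s''"
          and b: "reals s'' ''best'' 0 = wait (Suc i) c" by simp_all
        have s'': "nats s'' ''c'' 0 = c" "nats s'' ''o'' 0 = i * codes" "nats s'' ''codes'' 0 = codes"
          "reals s'' ''V'' = reals s' ''V''"
          using unchangedD[OF u] J o' preparedD(7)[OF p'] by simp_all
        have u'': "unchanged ?X s1 s''" using u' u by (rule unchanged_trans) auto
        have "n * codes + f \<noteq> i * codes + codes + c" if "n \<le> i" "f < codes" for n f
          using layer_index_less[OF that] by simp
        then show ?case
          using n b s'' u'' J by (simp add: unchanged_set less_Suc_eq del: wait.simps)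
      qed (use J in simp)
    qed
    then show "wp P (Seq ?inner (nset ''o'' (NAdd (nvar ''o'') (nvar ''codes'')))) s1
      (\<lambda>n s'. n \<le> layer_time \<and> ?I (Suc i) (set_nat ''j'' 0 (Suc (nats s' ''j'' 0)) s'))"
      unfolding wp_Seq
    proof (rule wp_mono, goal_cases)
      case (1 n s2)
      then have 1: "n \<le> 2 + codes * ((search_time + 1) + 2)" "unchanged ?X s1 s2" "?table i s2"
        "\<forall>f<codes. reals s2 ''V'' (i * codes + codes + f) = wait (Suc i) f" by blast+
      have p2: "prepared s2" using prepared_unchanged[OF p1 1(2)] by simp
      have s2: "nats s2 ''o'' 0 = i * codes" "nats s2 ''j'' 0 = i" "nats s2 ''codes'' 0 = codes"
        using unchangedD[OF 1(2)] I preparedD(7)[OF p2] by simp_all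
      have "unchanged ?Y s s2" using u1 1(2) by (rule unchanged_trans) auto
      moreover have "?table (Suc i) s2"
        using 1(3,4) by (auto simp: le_Suc_eq add_ac simp del: wait.simps)
      ultimately show ?case
        using 1(1) s2 by (simp add: unchanged_set layer_time_def distrib_left del: wait.simps)
    qed
  qed
  then show ?thesis unfolding all_layers_def wp_Seq[of _ "nset _ _"] wp_basic nval.simps
    by (rule wp_mono) auto
qed

lemma visited_less: "visited i < codes"
  by (cases i) (auto intro!: successor_less best_less)

lemma wp_read_plan:
  assumes p: "prepared s" and o: "nats s ''o'' 0 = horizon * codes"
    and V: "\<forall>n\<le>horizon. \<forall>f<codes. reals s ''V'' (n * codes + f) = wait n f"
  shows "wp P read_plan s (\<lambda>n s'. n \<le> 3 + horizon * (search_time + 3 * instants + 12) \<and>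
    nats s' ''horizon'' 0 = horizon \<and>
    (\<forall>m<horizon. reals s' ''d'' (Suc m) = instant (chosen_instant (Suc m)) \<and>
       reals s' ''y'' (Suc m) = level (chosen_level (Suc m))))"
proof -
  let ?X = "scratch \<union> {''c'', ''j'', ''o'', ''d'', ''y''}"
  let ?out = "\<lambda>i s'. \<forall>m<i. reals s' ''d'' (Suc m) = instant (chosen_instant (Suc m)) \<and>
       reals s' ''y'' (Suc m) = level (chosen_level (Suc m))"
  let ?I = "\<lambda>i s'. unchanged ?X s s' \<and> nats s' ''j'' 0 = i \<and> nats s' ''o'' 0 = (horizon - i) * codes \<and>
    nats s' ''c'' 0 = visited i \<and> ?out i s'"
  let ?body = "Seq (nset ''o'' (NSub (nvar ''o'') (nvar ''codes'')))
         (Seq search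
         (Seq (divide ''l1'' ''k1'' (nvar ''act'') ''levels'')
         (Seq (set_level ''y1'' (nvar ''k1''))
         (Seq (RSet ''d'' (NAdd (nvar ''j'') (NConst 1)) (instant_exp (nvar ''l1'')))
         (Seq (RSet ''y'' (NAdd (nvar ''j'') (NConst 1)) (rvar ''y1''))
              (nset ''c'' successor_exp))))))"
  have prep: "prepared s'" if "unchanged ?X s s'" for s'
    using prepared_unchanged[OF p that] by simp
  have "wp P (for_loop ''j'' (nvar ''horizon'') ?body) (set_nat ''c'' 0 0 s)
    (\<lambda>n s'. n \<le> 2 + horizon * ((search_time + 3 * instants + 10) + 2) \<and> ?I horizon s')"
  proof (rule wp_for_loop[where I = ?I and m = horizon])
    show "?I 0 (set_nat ''j'' 0 0 (set_nat ''c'' 0 0 s))" using o by (simp add: unchanged_set)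
    fix i s1 assume I: "?I i s1"
    then have p1: "prepared s1" and u1: "unchanged ?X s s1" using prep by blast+
    then show "nats s1 ''j'' 0 = i \<and> nval (nvar ''horizon'') s1 = horizon"
      using I preparedD(4) by simp
    assume i: "i < horizon"
    define s2 where "s2 = set_nat ''o'' 0 ((horizon - Suc i) * codes) s1"
    have u2: "unchanged ?X s s2" unfolding s2_def using u1 by (rule unchanged_set) simp
    have p2: "prepared s2" using prep[OF u2] .
    have s2: "nats s2 ''j'' 0 = i" "nats s2 ''o'' 0 = (horizon - Suc i) * codes"
      "nats s2 ''c'' 0 = visited i" "reals s2 = reals s1"
      using I by (simp_all add: s2_def)
    have V2: "reals s2 ''V'' (nats s2 ''o'' 0 + f) = wait (horizon - Suc i) f" if "f < codes" for f
      using V that unchangedD(2)[OF u2, of "''V''"] s2(2) by simp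
    have "nats s1 ''o'' 0 - nats s1 ''codes'' 0 = (horizon - Suc i) * codes"
      using I preparedD(7)[OF p1] i by (simp add: diff_mult_distrib)
    then have start: "wp P ?body s1 R = wp P (Seq search
         (Seq (divide ''l1'' ''k1'' (nvar ''act'') ''levels'')
         (Seq (set_level ''y1'' (nvar ''k1''))
         (Seq (RSet ''d'' (NAdd (nvar ''j'') (NConst 1)) (instant_exp (nvar ''l1'')))
         (Seq (RSet ''y'' (NAdd (nvar ''j'') (NConst 1)) (rvar ''y1''))
              (nset ''c'' successor_exp)))))) s2 (\<lambda>n. R (1 + n))" for R
      unfolding wp_Seq[of _ "nset _ _"] by (simp add: s2_def)
    show "wp P ?body s1 (\<lambda>n s'. n \<le> search_time + 3 * instants + 10 \<and>
      ?I (Suc i) (set_nat ''j'' 0 (Suc (nats s' ''j'' 0)) s'))"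
      unfolding start unfolding wp_Seq
    proof (rule wp_mono[OF wp_search[OF p2 s2(3) visited_less V2]], assumption, goal_cases)
      case (1 n3 s3)
      then have 1: "n3 \<le> search_time" "unchanged scratch s2 s3"
        "nats s3 ''rest'' 0 = visited i div levels mod tail_weight"
        "nats s3 ''act'' 0 = snd (best (wait (horizon - Suc i)) (visited i) actions)" by blast+
      have u3: "unchanged ?X s s3" using u2 1(2) by (rule unchanged_trans) auto
      have p3: "prepared s3" using prep[OF u3] .
      have s3: "nats s3 ''j'' 0 = i" "nats s3 ''o'' 0 = (horizon - Suc i) * codes"
        "nats s3 ''rest'' 0 = visited i div levels mod tail_weight"
        "nats s3 ''act'' 0 = chosen i" "reals s3 ''d'' = reals s1 ''d''" "reals s3 ''y'' = reals s1 ''y''"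
        using unchangedD[OF 1(2)] s2 1 by (simp_all add: chosen_def)
      have less: "chosen i < actions" unfolding chosen_def by (rule best_less) simp
      show ?case
      proof (rule wp_divideI, goal_cases)
        case (3 n4 s4)
        have u4: "unchanged ?X s s4" using u3 3(2) by (rule unchanged_trans) auto
        have p4: "prepared s4" using prep[OF u4] .
        have s4: "nats s4 ''l1'' 0 = chosen i div levels" "nats s4 ''k1'' 0 = chosen i mod levels"
          using 3(3,4) s3(4) preparedD(2)[OF p3] by simp_all
        have n4: "n4 \<le> 3 + 3 * instants"
          using 3(1) action_digits(1)[OF less] s3(4) preparedD(2)[OF p3] by simp
        show ?case
        proof (rule wp_set_levelI, goal_cases)
          case (2 n5 s5)
          have u5: "unchanged ?X s s5" using u4 2(2) by (rule unchanged_trans) auto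
          have p5: "prepared s5" using prep[OF u5] .
          have s5: "nats s5 ''j'' 0 = i" "nats s5 ''o'' 0 = (horizon - Suc i) * codes"
            "nats s5 ''rest'' 0 = visited i div levels mod tail_weight"
            "nats s5 ''l1'' 0 = chosen i div levels" "nats s5 ''k1'' 0 = chosen i mod levels"
            "reals s5 ''y1'' 0 = level (chosen i mod levels)"
            "reals s5 ''d'' = reals s1 ''d''" "reals s5 ''y'' = reals s1 ''y''"
            using 2(3,4) unchangedD[OF 2(2)] unchangedD[OF 3(2)] s3 s4 by simp_all
          have out: "chosen_instant (Suc i) = chosen i div levels" "chosen_level (Suc i) = chosen i mod levels"
            by (simp_all add: chosen_instant_def chosen_level_def)
          have vis: "visited (Suc i) = (visited i div levels mod tail_weight * instants + chosen i div levels) * levels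
              + chosen i mod levels"
            by (simp add: chosen_def[symmetric] successor_def)
          define s6 where "s6 = set_real ''d'' (Suc i) (instant (chosen_instant (Suc i))) s5"
          define s7 where "s7 = set_real ''y'' (Suc i) (level (chosen_level (Suc i))) s6"
          define s8 where "s8 = set_nat ''c'' 0 (visited (Suc i)) s7"
          have steps:
            "set_real ''d'' (nval (NAdd (nvar ''j'') (NConst 1)) s5) (rval P (instant_exp (nvar ''l1'')) s5) s5 = s6"
            "set_real ''y'' (nval (NAdd (nvar ''j'') (NConst 1)) s6) (rval P (rvar ''y1'') s6) s6 = s7"
            "set_nat ''c'' (nval (NConst 0) s7) (nval successor_exp s7) s7 = s8"
            unfolding s8_def vis
            by (simp_all add: s6_def s7_def out s5 preparedD[OF p5] successor_exp_def)
          have "unchanged ?X s s8"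
            unfolding s8_def s7_def s6_def by (intro unchanged_set u5) simp_all
          then have u9: "unchanged ?X s (set_nat ''j'' 0 (Suc (nats s8 ''j'' 0)) s8)" by (rule unchanged_set) simp
          have j8: "nats s8 ''j'' 0 = i" "nats s8 ''o'' 0 = (horizon - Suc i) * codes"
            "nats s8 ''c'' 0 = visited (Suc i)"
            by (simp_all add: s8_def s7_def s6_def s5 del: visited.simps)
          have "?out i s1" using I by blast
          then have "?out (Suc i) s8"
            by (simp add: s8_def s7_def s6_def s5 less_Suc_eq)
          then have out9: "?out (Suc i) (set_nat ''j'' 0 (Suc (nats s8 ''j'' 0)) s8)" by simp
          have time: "1 + (n3 + (n4 + (n5 + (1 + (1 + 1))))) \<le> search_time + 3 * instants + 10"
            using 1(1) n4 2(1) by linarith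
          have j9: "nats (set_nat ''j'' 0 (Suc (nats s8 ''j'' 0)) s8) ''j'' 0 = Suc i"
            "nats (set_nat ''j'' 0 (Suc (nats s8 ''j'' 0)) s8) ''o'' 0 = (horizon - Suc i) * codes"
            "nats (set_nat ''j'' 0 (Suc (nats s8 ''j'' 0)) s8) ''c'' 0 = visited (Suc i)"
            using j8 by simp_all
          show ?case
            unfolding wp_basic steps by (intro conjI time u9 j9 out9)
        qed (use preparedD[OF p4] in simp)
      qed (use preparedD[OF p3] in simp_all)
    qed
  qed
  then show ?thesis unfolding read_plan_def wp_Seq[of _ "nset _ _"] wp_basic nval.simps
  proof (rule wp_mono, goal_cases)
    case (1 n s')
    then have u: "unchanged ?X s s'" and rest: "?out horizon s'"
      and n: "n \<le> 2 + horizon * ((search_time + 3 * instants + 10) + 2)" by blast+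
    show ?case using preparedD(4)[OF prep[OF u]] rest n by (simp add: algebra_simps)
  qed
qed

lemma wp_prepare:
  assumes SM: "nats s ''S'' 0 = S" "nats s ''M'' 0 = M"
    and loads_least: "\<And>i. i < loads \<Longrightarrow> real i * capacity P < total_demand P"
    and rounds_least: "\<And>i. i < rounds \<Longrightarrow> real i * return_time P < last_departure P loads"
    and ticks_least: "\<And>i. i < ticks \<Longrightarrow> real i * return_time P < last_instant P loads rounds"
  shows "wp P prepare s (\<lambda>n s'. n \<le> 14 + 2 * (loads + rounds + ticks) + 3 * S \<and> prepared s')"
proof -
  let ?loop = "for_loop ''i'' (NSub (nvar ''S'') (NConst 1))
           (nset ''tail'' (NMul (nvar ''tail'') (nvar ''instants'')))"
  let ?last = "Seq (nset ''actions'' (NMul (nvar ''instants'') (nvar ''levels'')))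
         (nset ''codes'' (NMul (NMul (nvar ''tail'') (nvar ''instants'')) (nvar ''levels'')))"
  have loop: "wp P ?loop s' (\<lambda>n s''. n \<le> 2 + (S - 1) * (1 + 2) \<and>
      unchanged {''i'', ''tail''} s' s'' \<and> nats s'' ''tail'' 0 = tail_weight)"
    if s': "nats s' ''S'' 0 = S" "nats s' ''instants'' 0 = instants" "nats s' ''tail'' 0 = 1" for s'
  proof -
    let ?I = "\<lambda>i s''. unchanged {''i'', ''tail''} s' s'' \<and> nats s'' ''i'' 0 = i \<and>
      nats s'' ''tail'' 0 = instants ^ i"
    have "wp P ?loop s' (\<lambda>n s''. n \<le> 2 + (S - 1) * (1 + 2) \<and> ?I (S - 1) s'')"
    proof (rule wp_for_loop[where I = ?I and m = "S - 1"])
      show "?I 0 (set_nat ''i'' 0 0 s')" using s' by (simp add: unchanged_set)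
      fix i s'' assume I: "?I i s''"
      then have u: "unchanged {''i'', ''tail''} s' s''" by blast
      show "nats s'' ''i'' 0 = i \<and> nval (NSub (nvar ''S'') (NConst 1)) s'' = S - 1"
        using I unchangedD[OF u] s' by simp
      show "wp P (nset ''tail'' (NMul (nvar ''tail'') (nvar ''instants''))) s''
        (\<lambda>n s3. n \<le> 1 \<and> ?I (Suc i) (set_nat ''i'' 0 (Suc (nats s3 ''i'' 0)) s3))"
        using I unchangedD[OF u] s' by (simp add: unchanged_set)
    qed
    then show ?thesis by (rule wp_mono) (auto simp: tail_weight_def)
  qed
  show ?thesis
    unfolding prepare_def wp_Seq[of _ "round_up _ _ _"]
  proof (rule wp_mono[OF wp_round_up[OF loads loads_least]], assumption, simp add: total_exp_val, goal_cases)
    case (1 n1 s1)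
    then have n1: "n1 \<le> 2 + 2 * loads" and u1: "unchanged {''loads''} s s1"
      and v1: "nats s1 ''loads'' 0 = loads" by blast+
    have eval_departure: "rval P last_departure_exp s' = last_departure P loads"
      if "nats s' ''loads'' 0 = loads" for s'
      using that by (simp add: last_departure_exp_def last_departure_def naive_delay_def cargo_exp_def)
    show ?case
    proof (rule wp_mono[OF wp_round_up[OF rounds rounds_least]], goal_cases)
      case (2 s')
      then show ?case using v1 unchangedD(1)[OF 2(1)] by (simp add: eval_departure)
    next
      case (3 n2 s2)
      then have n2: "n2 \<le> 2 + 2 * rounds" and u2: "unchanged {''rounds''} s1 s2"
        and v2: "nats s2 ''rounds'' 0 = rounds" "nats s2 ''loads'' 0 = loads"
        using unchangedD(1)[of "{''rounds''}" s1 s2 "''loads''"] v1 by simp_all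
      show ?case
      proof (rule wp_mono[OF wp_round_up[OF ticks ticks_least]], goal_cases)
        case (2 s')
        then show ?case using v2 unchangedD(1)[OF 2(1)] eval_departure[of s']
          by (simp add: last_instant_exp_def last_instant_def cargo_exp_def)
      next
        case (3 n3 s3)
        then have n3: "n3 \<le> 2 + 2 * ticks" and u3: "unchanged {''ticks''} s2 s3"
          and v3: "nats s3 ''ticks'' 0 = ticks" by blast+
        have s3: "nats s3 ''rounds'' 0 = rounds" "nats s3 ''loads'' 0 = loads"
          "nats s3 ''S'' 0 = S" "nats s3 ''M'' 0 = M"
          using unchangedD(1)[OF u3] unchangedD(1)[OF u2] unchangedD(1)[OF u1] v2 SM by simp_all
        define s4 where "s4 = set_nat ''tail'' 0 1 (set_nat ''horizon'' 0 horizon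
          (set_nat ''instants'' 0 instants (set_nat ''levels'' 0 levels s3)))"
        have s4: "nats s4 ''S'' 0 = S" "nats s4 ''M'' 0 = M" "nats s4 ''ticks'' 0 = ticks"
          "nats s4 ''instants'' 0 = instants" "nats s4 ''levels'' 0 = levels"
          "nats s4 ''horizon'' 0 = horizon" "nats s4 ''tail'' 0 = 1"
          using s3 v3 by (simp_all add: s4_def)
        have start: "wp P (Seq (nset ''levels'' (NAdd (NMul (nvar ''M'') (nvar ''loads'')) (NConst 1)))
            (Seq (nset ''instants'' (NMul (nvar ''M'') (nvar ''ticks'')))
            (Seq (nset ''horizon'' (NMul (nvar ''S'') (nvar ''rounds'')))
            (Seq (nset ''tail'' (NConst 1)) (Seq ?loop ?last))))) s3 R
          = wp P ?loop s4 (\<lambda>n s5. wp P ?last s5 (\<lambda>m s6. R (4 + (n + m)) s6))" for R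
        proof -
          have "levels = nats s3 ''M'' 0 * nats s3 ''loads'' 0 + 1" "instants = nats s3 ''M'' 0 * nats s3 ''ticks'' 0"
            "horizon = nats s3 ''S'' 0 * nats s3 ''rounds'' 0"
            using s3 v3 by (simp_all add: levels_def instants_def horizon_def)
          then show ?thesis
            unfolding wp_Seq[of _ "nset _ _"] wp_Seq[of _ ?loop] by (simp add: s4_def numeral_eq_Suc)
        qed
        show ?case
          unfolding start
        proof (rule wp_mono[OF loop], goal_cases)
          case (4 n5 s5)
          then have n5: "n5 \<le> 2 + (S - 1) * (1 + 2)" and u5: "unchanged {''i'', ''tail''} s4 s5"
            and v5: "nats s5 ''tail'' 0 = tail_weight" by blast+
          have "n1 + (n2 + (n3 + (4 + (n5 + 2)))) \<le> 14 + 2 * (loads + rounds + ticks) + 3 * S"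
            using n1 n2 n3 n5 by simp
          then show ?case
            using unchangedD(1)[OF u5] s4 v5
            by (simp add: wp_Seq prepared_def actions_def codes_def numeral_eq_Suc)
        qed (use s4 in simp_all)
      qed simp
    qed simp
  qed
qed

definition total_time :: nat where
  "total_time = 14 + 2 * (loads + rounds + ticks) + 3 * S + (2 + codes * (3 * codes + 10))
     + (3 + horizon * (layer_time + 2)) + (3 + horizon * (search_time + 3 * instants + 12)) + 1"

lemma wp_program:
  assumes "\<And>i. i < loads \<Longrightarrow> real i * capacity P < total_demand P"
    and "\<And>i. i < rounds \<Longrightarrow> real i * return_time P < last_departure P loads"
    and "\<And>i. i < ticks \<Longrightarrow> real i * return_time P < last_instant P loads rounds"
  shows "wp P program (input_state S M) (\<lambda>n s. n \<le> total_time \<and> nats s ''n'' 0 = horizon \<and>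
    (\<forall>m<horizon. reals s ''d'' (Suc m) = instant (chosen_instant (Suc m)) \<and>
       reals s ''y'' (Suc m) = level (chosen_level (Suc m))))"
proof -
  have init: "nats (input_state S M) ''S'' 0 = S" "nats (input_state S M) ''M'' 0 = M"
    by (simp_all add: input_state_def)
  show ?thesis
    unfolding program_def wp_Seq[of _ prepare]
  proof (rule wp_mono[OF wp_prepare[OF init assms]], assumption, assumption, assumption, goal_cases)
    case (1 n1 s1)
    then have n1: "n1 \<le> 14 + 2 * (loads + rounds + ticks) + 3 * S" and p1: "prepared s1" by blast+
    show ?case
      unfolding wp_Seq[of _ last_layer]
    proof (rule wp_mono[OF wp_last_layer[OF p1]], goal_cases)
      case (1 n2 s2)
      then have n2: "n2 \<le> 2 + codes * (3 * codes + 10)"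
        and u2: "unchanged (scratch \<union> {''c'', ''V''}) s1 s2"
        and V2: "\<forall>f<codes. reals s2 ''V'' f = wait 0 f" by blast+
      have p2: "prepared s2" using prepared_unchanged[OF p1 u2] by simp
      show ?case
        unfolding wp_Seq[of _ all_layers]
      proof (rule wp_mono[OF wp_all_layers[OF p2 V2]], goal_cases)
        case (1 n3 s3)
        then have n3: "n3 \<le> 3 + horizon * (layer_time + 2)"
          and u3: "unchanged (scratch \<union> {''c'', ''V'', ''j'', ''o''}) s2 s3"
          and o3: "nats s3 ''o'' 0 = horizon * codes"
          and V3: "\<forall>n\<le>horizon. \<forall>f<codes. reals s3 ''V'' (n * codes + f) = wait n f" by blast+
        have p3: "prepared s3" using prepared_unchanged[OF p2 u3] by simp
        show ?case
          unfolding wp_Seq[of _ read_plan]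
          by (rule wp_mono[OF wp_read_plan[OF p3 o3 V3]])
            (use n1 n2 n3 in \<open>simp add: total_time_def\<close>)
      qed
    qed
  qed
qed

text \<open>All numbers of levels and instants are at most \<open>X = M * m\<close> with \<open>m\<close> depending only on the service.
  The dominating terms are \<open>codes\<^sup>2\<close> for decoding states and \<open>codes * actions * instants\<close> for scanning
  and decoding actions; their exponents \<open>2 S + 2\<close> and \<open>S + 4\<close> are at most \<open>3 S + 2\<close>. The factor
  \<open>S\<close> of the horizon is bounded by \<open>2^(3 S)\<close>, which is the reason for the \<open>2\<close> in the base.\<close>

lemma total_time_le:
  "total_time \<le> (39 + 2 * (loads + rounds + ticks) + 123 * rounds) * (loads + 1 + ticks)\<^sup>2 *
     ((2 * (loads + 1 + ticks)) ^ (3 * S) * M ^ (3 * S + 2))"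
proof -
  define m where "m = loads + 1 + ticks"
  define X where "X = M * m"
  define W where "W = X ^ (3 * S + 2)"
  have X: "1 \<le> X" "levels \<le> X" "instants \<le> X"
    using M by (auto simp: X_def m_def levels_def instants_def add_mult_distrib2)
  have pow: "X ^ i \<le> W" if "i \<le> 3 * S + 2" for i
    unfolding W_def using X(1) that by (rule power_increasing[rotated])
  have W1: "1 \<le> W" using pow[of 0] by simp
  have codes: "codes \<le> X ^ (S + 1)"
    unfolding codes_def power_eq power_add using X by (intro mult_mono power_mono) auto
  have acts: "actions \<le> X ^ 2"
    unfolding actions_def power2_eq_square using X by (intro mult_mono) auto
  have c1: "codes \<le> W" using codes pow[of "S + 1"] by simp
  have i1: "instants \<le> W" using X(3) pow[of 1] by simp
  have c2: "codes * codes \<le> W"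
  proof -
    have "codes * codes \<le> X ^ (S + 1) * X ^ (S + 1)" using codes by (intro mult_mono) auto
    also have "\<dots> \<le> W" unfolding power_add[symmetric] by (rule pow) simp
    finally show ?thesis .
  qed
  have c3: "codes * (actions * instants) \<le> W"
  proof -
    have "codes * (actions * instants) \<le> X ^ (S + 1) * (X ^ 2 * X ^ 1)"
      using codes acts X by (intro mult_mono) auto
    also have "\<dots> \<le> W" unfolding power_add[symmetric] by (rule pow) (use S in simp)
    finally show ?thesis .
  qed
  have "codes * actions \<le> codes * (actions * instants)"
    using pos(2) by (metis mult.assoc mult_le_mono2 mult.right_neutral less_eq_Suc_le One_nat_def)
  then have c4: "codes * actions \<le> W" using c3 by (rule le_trans)
  have "codes * search_time = 16 * codes + 9 * (codes * codes) + 3 * (codes * (actions * instants)) + 22 * (codes * actions)"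
    by (simp add: search_time_def algebra_simps)
  then have s1: "codes * search_time \<le> 50 * W" using c1 c2 c3 c4 by linarith
  have "search_time \<le> codes * search_time" using pos(5) by (metis Suc_leI One_nat_def mult_le_mono1 mult_1)
  then have s2: "search_time \<le> 50 * W" using s1 by (rule le_trans)
  have "layer_time = codes * search_time + 3 * codes + 3" by (simp add: layer_time_def algebra_simps)
  then have "layer_time + 2 \<le> 58 * W" using s1 c1 W1 by linarith
  then have h1: "horizon * (layer_time + 2) \<le> horizon * (58 * W)" by (rule mult_le_mono2)
  have "search_time + 3 * instants + 12 \<le> 65 * W" using s2 i1 W1 by linarith
  then have h2: "horizon * (search_time + 3 * instants + 12) \<le> horizon * (65 * W)" by (rule mult_le_mono2)
  have l: "codes * (3 * codes + 10) \<le> 13 * W"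
    using c1 c2 by (simp add: algebra_simps)
  have k: "14 + 2 * (loads + rounds + ticks) + 3 * S + 9 \<le> (23 + 2 * (loads + rounds + ticks) + 3 * S) * W"
  proof -
    have "14 + 2 * (loads + rounds + ticks) + 3 * S + 9 = (23 + 2 * (loads + rounds + ticks) + 3 * S) * 1" by simp
    also have "\<dots> \<le> (23 + 2 * (loads + rounds + ticks) + 3 * S) * W" using W1 by (rule mult_le_mono2)
    finally show ?thesis .
  qed
  have "total_time \<le> (23 + 2 * (loads + rounds + ticks) + 3 * S) * W + 13 * W + horizon * (58 * W) + horizon * (65 * W)"
    unfolding total_time_def using h1 h2 l k by linarith
  also have "\<dots> = (36 + 2 * (loads + rounds + ticks) + 3 * S + 123 * (S * rounds)) * W"
    by (simp add: horizon_def algebra_simps)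
  also have "\<dots> \<le> (S * (39 + 2 * (loads + rounds + ticks) + 123 * rounds)) * W"
  proof (rule mult_le_mono1)
    have "1 * (36 + 2 * (loads + rounds + ticks)) \<le> S * (36 + 2 * (loads + rounds + ticks))" using S by (rule mult_le_mono1)
    then show "36 + 2 * (loads + rounds + ticks) + 3 * S + 123 * (S * rounds) \<le> S * (39 + 2 * (loads + rounds + ticks) + 123 * rounds)"
      by (simp add: algebra_simps)
  qed
  also have "\<dots> \<le> (2 ^ (3 * S) * (39 + 2 * (loads + rounds + ticks) + 123 * rounds)) * W"
  proof (intro mult_le_mono1)
    have "S < 2 ^ S" by (rule less_exp)
    also have "(2::nat) ^ S \<le> 2 ^ (3 * S)" by (intro power_increasing) auto
    finally show "S \<le> 2 ^ (3 * S)" by simp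
  qed
  also have "\<dots> = (39 + 2 * (loads + rounds + ticks) + 123 * rounds) * m\<^sup>2 * ((2 * m) ^ (3 * S) * M ^ (3 * S + 2))"
    by (simp add: W_def X_def power_add power_mult_distrib power2_eq_square mult_ac)
  finally show ?thesis by (simp only: m_def)
qed

text \<open>The output convention for further departures is that of \<open>plan_d\<close> and \<open>plan_y\<close>. The entry \<open>d 0\<close>
  is excluded, being arbitrary.\<close>

lemma output_plan:
  assumes n: "nats s ''n'' 0 = horizon"
    and out: "\<forall>m<horizon. reals s ''d'' (Suc m) = instant (chosen_instant (Suc m)) \<and>
       reals s ''y'' (Suc m) = level (chosen_level (Suc m))"
  shows "output_y s = plan_y" "output_d P s (Suc j) = plan_d (Suc j)"
proof -
  have "\<exists>m<horizon. min (Suc j) horizon = Suc m" for j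
    using pos(6) by (cases "Suc j \<le> horizon") (auto simp: min_def intro: exI[of _ "horizon - 1"])
  then have *: "reals s ''d'' (min (Suc j) horizon) = instant (chosen_instant (min (Suc j) horizon))"
    "reals s ''y'' (min (Suc j) horizon) = level (chosen_level (min (Suc j) horizon))" for j
    using out by metis+
  show "output_d P s (Suc j) = plan_d (Suc j)"
    by (simp add: output_d_def plan_d_def n Let_def * del: min_Suc1 min_Suc2)
  have "output_y s j = plan_y j" for j
    by (cases j) (simp_all add: output_y_def plan_y_def n * chosen_digits(4) del: min_Suc1 min_Suc2)
  then show "output_y s = plan_y" ..
qed

end

lemma least_multiple:
  fixes a b :: real
  assumes "0 < b"
  obtains n :: nat where "a \<le> real n * b" "\<And>i. i < n \<Longrightarrow> real i * b < a"
proof -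
  obtain k :: nat where "a \<le> real k * b"
    using reals_Archimedean3[OF assms] by (metis less_imp_le)
  then have "a \<le> real (LEAST n. a \<le> real n * b) * b" by (rule LeastI)
  moreover have "real i * b < a" if "i < (LEAST n. a \<le> real n * b)" for i
    using not_less_Least[OF that] by simp
  ultimately show ?thesis using that by blast
qed

theorem theorem3:
  "\<exists>prog :: com. \<forall>(P :: service) (D' :: real \<Rightarrow> real).
     valid_service P \<and>
     (\<forall>t\<in>{0..<period P}. (demand P has_real_derivative D' t) (at_right t)) \<and>
     return_time P > 0 \<and>
     (INF t\<in>{0..<period P}. D' t) > 0 \<longrightarrow>
     (\<exists>\<beta>>0. \<exists>K L :: real. \<forall>(S :: nat) (M :: nat). S \<ge> 1 \<and> M \<ge> 1 \<longrightarrow>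
       (\<exists>(time :: nat) (s :: state).
          exec P prog (input_state S M) time s \<and>
          real time \<le> K * (\<beta> ^ (3 * S) * real M ^ (3 * S + 2)) \<and>
          feasible_return P S (output_d P s) (output_y s) \<and>
          g_max P (output_d P s) (output_y s) \<le> OPT_return P S + ereal (L * (real S ^ 2 / real M))))"
proof (intro exI[of _ program] allI impI, elim conjE)
  fix P :: service and D' :: "real \<Rightarrow> real"
  assume valid: "valid_service P"
    and deriv: "\<forall>t\<in>{0..<period P}. (demand P has_real_derivative D' t) (at_right t)"
    and ret: "return_time P > 0" and inf: "(INF t\<in>{0..<period P}. D' t) > 0"
  obtain b where b: "0 < b"
    "\<And>s t. 0 \<le> s \<Longrightarrow> s \<le> t \<Longrightarrow> t \<le> period P \<Longrightarrow> demand P s + b * (t - s) \<le> demand P t"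
    using demand_growth[OF valid deriv inf] by blast
  obtain loads where loads_least: "total_demand P \<le> real loads * capacity P"
    "\<And>i. i < loads \<Longrightarrow> real i * capacity P < total_demand P"
    using least_multiple[OF valid_serviceD(1)[OF valid], of "total_demand P"] by blast
  obtain rounds where rounds_least: "last_departure P loads \<le> real rounds * return_time P"
    "\<And>i. i < rounds \<Longrightarrow> real i * return_time P < last_departure P loads"
    using least_multiple[OF ret, of "last_departure P loads"] by blast
  obtain ticks where ticks_least: "last_instant P loads rounds \<le> real ticks * return_time P"
    "\<And>i. i < ticks \<Longrightarrow> real i * return_time P < last_instant P loads rounds"
    using least_multiple[OF ret, of "last_instant P loads rounds"] by blast
  define \<beta> where "\<beta> = real (2 * (loads + 1 + ticks))"
  define K where "K = real ((39 + 2 * (loads + rounds + ticks) + 123 * rounds) * (loads + 1 + ticks)\<^sup>2)"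
  define L where "L = loading P * capacity P + capacity P / b
       + real rounds * (return_time P + loading P * capacity P) + return_time P"
  have L: "0 \<le> L" using valid_serviceD(1,3)[OF valid] ret b(1) by (simp add: L_def)
  have "\<exists>time s. exec P program (input_state S M) time s \<and>
          real time \<le> K * (\<beta> ^ (3 * S) * real M ^ (3 * S + 2)) \<and>
          feasible_return P S (output_d P s) (output_y s) \<and>
          g_max P (output_d P s) (output_y s) \<le> OPT_return P S + ereal (L * (real S ^ 2 / real M))"
    if SM: "S \<ge> 1 \<and> M \<ge> 1" for S M :: nat
  proof -
    interpret shuttle_grid P S M loads rounds ticks
      using SM valid ret loads_least(1) rounds_least(1) ticks_least(1) by unfold_locales auto
    obtain time s where run: "exec P program (input_state S M) time s" "time \<le> total_time"
      and n: "nats s ''n'' 0 = horizon"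
      and out: "\<forall>m<horizon. reals s ''d'' (Suc m) = instant (chosen_instant (Suc m)) \<and>
         reals s ''y'' (Suc m) = level (chosen_level (Suc m))"
      using wp_program[OF loads_least(2) rounds_least(2) ticks_least(2)] unfolding wp_def by blast
    note y = output_plan(1)[OF n out] and d = output_plan(2)[OF n out]
    have "real time \<le> real total_time" using run(2) by simp
    also have "\<dots> \<le> K * (\<beta> ^ (3 * S) * real M ^ (3 * S + 2))"
      using total_time_le unfolding K_def \<beta>_def
      by (metis of_nat_le_iff of_nat_mult of_nat_power)
    finally have time: "real time \<le> K * (\<beta> ^ (3 * S) * real M ^ (3 * S + 2))" .
    note plan = plan_near_optimal[OF b, folded L_def]
    have feas: "feasible_return P S (output_d P s) (output_y s)"
      using plan(1) unfolding feasible_return_Suc y by (simp add: d)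
    have "g_max P (output_d P s) (output_y s) = g_max P plan_d plan_y"
      unfolding g_max_def y
    proof (rule SUP_cong)
      fix j assume "j \<in> {j. j \<ge> 1 \<and> plan_y j > plan_y (j - 1)}"
      then show "ereal (output_d P s j - tau P (plan_y (j - 1))) = ereal (plan_d j - tau P (plan_y (j - 1)))"
        using d[of "j - 1"] by simp
    qed simp
    also have "\<dots> \<le> OPT_return P S + ereal (L / real M)" by (rule plan(2))
    also have "\<dots> \<le> OPT_return P S + ereal (L * (real S ^ 2 / real M))"
    proof -
      have "1 \<le> real S ^ 2" using SM by simp
      then have "L * 1 \<le> L * real S ^ 2" using L by (rule mult_left_mono)
      then have "L / real M \<le> L * real S ^ 2 / real M" by (simp add: divide_right_mono)
      then show ?thesis by (intro add_left_mono) simp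
    qed
    finally show ?thesis using run(1) time feas by blast
  qed
  moreover have "\<beta> > 0" by (simp add: \<beta>_def)
  ultimately show "\<exists>\<beta>>0. \<exists>K L :: real. \<forall>(S :: nat) (M :: nat). S \<ge> 1 \<and> M \<ge> 1 \<longrightarrow>
       (\<exists>(time :: nat) (s :: state).
          exec P program (input_state S M) time s \<and>
          real time \<le> K * (\<beta> ^ (3 * S) * real M ^ (3 * S + 2)) \<and>
          feasible_return P S (output_d P s) (output_y s) \<and>
          g_max P (output_d P s) (output_y s) \<le> OPT_return P S + ereal (L * (real S ^ 2 / real M)))"
    by blast
qed

end
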